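(* Let $\varepsilon_A^{\delta},\varepsilon_B^{\delta}$ ($\delta\ge 0$) be a family of permittivities as in the context, with $\varepsilon_j^{0}$ real-valued (undamped), $\mathrm{Re}(\varepsilon_j^\delta)=\varepsilon_j^0$ for all $\delta$, and $\lim_{\delta\to0}\sup_{x\in\mathbb{R}}|\mathrm{Im}(\varepsilon_j^\delta(x))|=0$ for $j=A,B$. Let $Z^{(U)}$ be the interface impedance for $\delta=0$, let $Z^{(D)}=Z^{(D),\delta}$ be the interface impedance for $\delta>0$, and let $\mathfrak{A}(\delta)\subset\mathbb{C}$ be the common (complex) band gap for parameter $\delta$. Then for each root $\omega_U\in\mathfrak{A}(0)$ of $Z^{(U)}$ there exists, for all sufficiently small $\delta>0$, a root $\omega_D=\omega_D(\delta)\in\mathfrak{A}(\delta)$ of $Z^{(D)}$, such that $\omega_D(\delta)\to\omega_U$ as $\delta\to0$.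
   Context: Fix a real constant $\mu_0>0$ and a point $x_0\in\mathbb{R}$. For $j\in\{A,B\}$ and each $\delta$, $\varepsilon_j=\varepsilon_j^\delta:\mathbb{R}\to\mathbb{C}$ is piecewise smooth (finitely many breakpoints per period, with one-sided limits), has $\mathrm{Re}(\varepsilon_j)>0$ (also for one-sided limits), is $1$-periodic, and is inversion symmetric: $\varepsilon_j(x_0+h)=\varepsilon_j(x_0+1-h)$ for $h\in(0,1)$. Put $\mathcal{L}_ju=-\frac{1}{\mu_0}\left(\frac{1}{\varepsilon_j}u'\right)'$; solutions of $\mathcal{L}_ju=\omega^2u$ are understood with $u$ and $\frac{1}{\varepsilon_j}u'$ continuous. The Floquet–Bloch spectrum of material $j$ is the set of $\omega\in\mathbb{C}$ for which there are $\kappa\in[-\pi,\pi]$ and a nonzero solution $u$ of $\mathcal{L}_ju=\omega^2u$ on $\mathbb{R}$ with $u(x+1)=e^{i\kappa}u(x)$ and $u'(x+1)=e^{i\kappa}u'(x)$. The common band gap $\mathfrak{A}(\delta)$ is the set of $\omega\in\mathbb{C}$ lying in neither the Floquet–Bloch spectrum of material $A$ nor that of material $B$ (with permittivities $\varepsilon_A^\delta,\varepsilon_B^\delta$). For $\omega$ in the common band gap, let $u_A(\cdot,\omega)$ (resp. $u_B(\cdot,\omega)$) be the nonzero solution, unique up to scaling, of $\mathcal{L}_Au=\omega^2u$ (resp. $\mathcal{L}_Bu=\omega^2u$) which decays together with its derivative as $x\to-\infty$ (resp. $x\to+\infty$). The surface impedances are $$Z_A(\omega)=-\frac{u_A(x_0^-,\omega)}{\frac{1}{\varepsilon_A(x_0^-)}u_A'(x_0^-,\omega)},\qquad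 Z_B(\omega)=\frac{u_B(x_0^+,\omega)}{\frac{1}{\varepsilon_B(x_0^+)}u_B'(x_0^+,\omega)},$$ and the interface impedance is $Z(\omega)=Z_A(\omega)+Z_B(\omega)$. *)

theory Defs
  imports "HOL-Analysis.Analysis"
begin

definition smooth_near :: "(real \<Rightarrow> complex) \<Rightarrow> real \<Rightarrow> bool" where
  "smooth_near f x \<longleftrightarrow>
     (\<exists>U. open U \<and> x \<in> U \<and>
        (\<forall>n. \<forall>y\<in>U. ((\<lambda>g t. vector_derivative g (at t)) ^^ n) f differentiable (at y)))"

definition breakpoints :: "(real \<Rightarrow> complex) \<Rightarrow> real set" where
  "breakpoints f = {x. \<not> smooth_near f x}"

definition has_one_sided_limits :: "(real \<Rightarrow> complex) \<Rightarrow> bool" where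
  "has_one_sided_limits f \<longleftrightarrow>
     (\<forall>x. (\<exists>l. (f \<longlongrightarrow> l) (at_left x)) \<and> (\<exists>l. (f \<longlongrightarrow> l) (at_right x)))"

text \<open>The standing assumptions on a permittivity. The values at breakpoints are unconstrained apart
  from the positivity of the real part, periodicity and inversion symmetry.\<close>

definition permittivity :: "real \<Rightarrow> (real \<Rightarrow> complex) \<Rightarrow> bool" where
  "permittivity x0 eps \<longleftrightarrow>
     finite (breakpoints eps \<inter> {0..<1}) \<and>
     has_one_sided_limits eps \<and>
     (\<forall>x. Re (eps x) > 0) \<and>
     (\<forall>x. Re (Lim (at_left x) eps) > 0) \<and>
     (\<forall>x. Re (Lim (at_right x) eps) > 0) \<and>
     (\<forall>x. eps (x + 1) = eps x) \<and>
     (\<forall>h\<in>{0<..<1}. eps (x0 + h) = eps (x0 + 1 - h))"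

definition flux :: "(real \<Rightarrow> complex) \<Rightarrow> (real \<Rightarrow> complex) \<Rightarrow> real \<Rightarrow> complex" where
  "flux eps u x = 1 / eps x * vector_derivative u (at x)"

definition L_op :: "real \<Rightarrow> (real \<Rightarrow> complex) \<Rightarrow> (real \<Rightarrow> complex) \<Rightarrow> real \<Rightarrow> complex" where
  "L_op mu0 eps u x = - (1 / complex_of_real mu0) * vector_derivative (flux eps u) (at x)"

text \<open>The equation holds pointwise off the breakpoints. At a breakpoint \<open>u\<close> need not be
  differentiable, so continuity of the flux there means that the flux has a continuous
  extension \<open>v\<close> to the whole line.\<close>

definition solution ::
    "real \<Rightarrow> (real \<Rightarrow> complex) \<Rightarrow> complex \<Rightarrow> (real \<Rightarrow> complex) \<Rightarrow> bool" where
  "solution mu0 eps \<omega> u \<longleftrightarrow>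
     continuous_on UNIV u \<and>
     (\<exists>v. continuous_on UNIV v \<and> (\<forall>x. x \<notin> breakpoints eps \<longrightarrow> v x = flux eps u x)) \<and>
     (\<forall>x. x \<notin> breakpoints eps \<longrightarrow>
        u differentiable (at x) \<and> flux eps u differentiable (at x) \<and>
        L_op mu0 eps u x = \<omega>\<^sup>2 * u x)"

definition floquet_bloch_spectrum :: "real \<Rightarrow> (real \<Rightarrow> complex) \<Rightarrow> complex set" where
  "floquet_bloch_spectrum mu0 eps =
     {\<omega>. \<exists>\<kappa>\<in>{-pi..pi}. \<exists>u. solution mu0 eps \<omega> u \<and> (\<exists>x. u x \<noteq> 0) \<and>
        (\<forall>x. u (x + 1) = exp (\<i> * complex_of_real \<kappa>) * u x) \<and>
        (\<forall>x. x \<notin> breakpoints eps \<longrightarrow>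
           vector_derivative u (at (x + 1)) =
             exp (\<i> * complex_of_real \<kappa>) * vector_derivative u (at x))}"

definition common_band_gap ::
    "real \<Rightarrow> (real \<Rightarrow> complex) \<Rightarrow> (real \<Rightarrow> complex) \<Rightarrow> complex set" where
  "common_band_gap mu0 epsA epsB =
     - (floquet_bloch_spectrum mu0 epsA \<union> floquet_bloch_spectrum mu0 epsB)"

text \<open>Decay of \<open>u\<close> and \<open>u'\<close> along the filter \<open>F\<close>, the derivative being considered
  only where it is defined.\<close>

definition decays_along ::
    "real filter \<Rightarrow> (real \<Rightarrow> complex) \<Rightarrow> (real \<Rightarrow> complex) \<Rightarrow> bool" where
  "decays_along F eps u \<longleftrightarrow>
     (u \<longlongrightarrow> 0) F \<and>
     ((\<lambda>x. vector_derivative u (at x)) \<longlongrightarrow> 0) (inf F (principal (- breakpoints eps)))"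

text \<open>For \<open>\<omega>\<close> outside the Floquet-Bloch spectrum the decaying solution exists and is unique up
  to scaling; a representative is chosen, and the impedances do not depend on the choice.\<close>

definition decaying_solution ::
    "real \<Rightarrow> real filter \<Rightarrow> (real \<Rightarrow> complex) \<Rightarrow> complex \<Rightarrow> real \<Rightarrow> complex" where
  "decaying_solution mu0 F eps \<omega> =
     (SOME u. solution mu0 eps \<omega> u \<and> (\<exists>x. u x \<noteq> 0) \<and> decays_along F eps u)"

text \<open>The one-sided values at \<open>x0\<close> are one-sided limits. The denominators do not vanish in the
  band gap: by inversion symmetry the two diagonal entries of the transfer matrix \<open>T\<close> over
  \<open>[x0, x0 + 1]\<close>, acting on the pair of \<open>u\<close> and its flux, coincide, so if the flux of a decaying
  solution vanished at \<open>x0\<close>, then \<open>det T = 1\<close> would force its Floquet multiplier to be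
  \<open>1\<close> or \<open>-1\<close>. Hence the convention \<open>z / 0 = 0\<close> creates no spurious roots.\<close>

definition Z_A :: "real \<Rightarrow> real \<Rightarrow> (real \<Rightarrow> complex) \<Rightarrow> complex \<Rightarrow> complex" where
  "Z_A mu0 x0 eps \<omega> =
     (let u = decaying_solution mu0 at_bot eps \<omega>
      in - (Lim (at_left x0) u /
            (1 / Lim (at_left x0) eps * Lim (at_left x0) (\<lambda>x. vector_derivative u (at x)))))"

definition Z_B :: "real \<Rightarrow> real \<Rightarrow> (real \<Rightarrow> complex) \<Rightarrow> complex \<Rightarrow> complex" where
  "Z_B mu0 x0 eps \<omega> =
     (let u = decaying_solution mu0 at_top eps \<omega>
      in Lim (at_right x0) u /
           (1 / Lim (at_right x0) eps * Lim (at_right x0) (\<lambda>x. vector_derivative u (at x))))"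

definition interface_impedance ::
    "real \<Rightarrow> real \<Rightarrow> (real \<Rightarrow> complex) \<Rightarrow> (real \<Rightarrow> complex) \<Rightarrow> complex \<Rightarrow> complex" where
  "interface_impedance mu0 x0 epsA epsB \<omega> = Z_A mu0 x0 epsA \<omega> + Z_B mu0 x0 epsB \<omega>"

text \<open>A family of permittivities indexed by \<open>\<delta> \<ge> 0\<close> with vanishing damping. Each
  permittivity is bounded (it is periodic with one-sided limits everywhere), so
  the real supremum is the genuine one.\<close>

definition damped_family :: "real \<Rightarrow> (real \<Rightarrow> real \<Rightarrow> complex) \<Rightarrow> bool" where
  "damped_family x0 eps \<longleftrightarrow>
     (\<forall>\<delta>\<ge>0. permittivity x0 (eps \<delta>)) \<and>
     (\<forall>x. eps 0 x \<in> \<real>) \<and>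
     (\<forall>\<delta>\<ge>0. \<forall>x. complex_of_real (Re (eps \<delta> x)) = eps 0 x) \<and>
     ((\<lambda>\<delta>. SUP x. \<bar>Im (eps \<delta> x)\<bar>) \<longlongrightarrow> 0) (at_right 0)"

end

(* A permittivity that is symmetric about x0 has a transfer matrix over one period of the form
   ((a, b), (c, a)) with a^2 - b c = 1, acting on the pair of u and its flux. Hence omega lies in the
   Floquet-Bloch spectrum iff a is in [-1, 1]. Off the spectrum let s be the root of a^2 - 1 for which
   |a + s| < 1: the solutions decaying to the right and to the left start with (b, s) and (b, -s),
   so both surface impedances are b / s, and the roots of the interface impedance are the zeros of
   bA sB + bB sA. This function is holomorphic in omega, since a and b are entire (they are given by
   Picard iteration), and it converges locally uniformly as the damping vanishes, so Hurwitz' theorem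
   yields the roots, provided that the undamped function is not identically zero near omega_U. It is not:
   without damping, Im (omega^2) Im (b / s) < 0 for both materials whenever omega^2 is not real. *)

theory Submission
  imports Defs "HOL-Complex_Analysis.Complex_Analysis"
begin

section \<open>Primitives of piecewise continuous functions\<close>

text \<open>Since \<open>eps\<close> jumps, the equation is read as the system u' = eps v, v' = -
  mu0 \<omega>^2 u for \<open>u\<close> and its flux \<open>v\<close>: both are continuous, and
  derivatives exist only off a locally finite set. The coefficient matrix has trace zero, so
  Wronskians are constant; this supplies uniqueness of solutions and the determinant of the transfer
  matrix. Hurwitz' theorem needs functions holomorphic on a fixed neighbourhood for all small
  \<delta>, whereas the gap itself depends on \<delta>. The gap consists of the \<omega> for which
  the entry a of each material avoids [-1, 1], an open condition; locally uniform convergence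
  therefore keeps a neighbourhood of the undamped root inside every gap, with the values of a in a
  compact set on which s is uniformly continuous. What results is a root in each ball for all
  \<delta> below a bound depending on the ball. A single function of \<delta> is obtained by taking
  a root whose distance to the undamped one is within \<delta> of the infimum.\<close>

definition locally_finite_set :: "real set \<Rightarrow> bool" where
  "locally_finite_set B \<longleftrightarrow> (\<forall>a b. finite (B \<inter> {a..b}))"

definition locally_integrable :: "(real \<Rightarrow> complex) \<Rightarrow> bool" where
  "locally_integrable f \<longleftrightarrow> (\<forall>a b. f integrable_on {a..b})"

text \<open>Just enough regularity for a coefficient of the system: products with continuous
  functions are integrable, and their primitives are differentiable off a locally finite set. One
  bound \<open>M\<close> will serve for both coefficients, \<open>eps\<close> and
  \<open>- mu0\<close>, so that the Picard estimates stay plain powers \<open>M ^ n\<close>.\<close>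

definition weight :: "real \<Rightarrow> (real \<Rightarrow> complex) \<Rightarrow> bool" where
  "weight M f \<longleftrightarrow> (\<forall>x. norm (f x) \<le> M) \<and>
     (\<exists>B. locally_finite_set B \<and> (\<forall>x. x \<notin> B \<longrightarrow> isCont f x))"

lemma locally_finite_set_empty: "locally_finite_set {}"
  by (simp add: locally_finite_set_def)

lemma locally_finite_set_Un:
  assumes "locally_finite_set B" "locally_finite_set C"
  shows "locally_finite_set (B \<union> C)"
  using assms by (auto simp: locally_finite_set_def Int_Un_distrib2)

lemma locally_finite_set_vimage_translate:
  assumes "locally_finite_set B"
  shows "locally_finite_set {x. x + p \<in> B}"
  unfolding locally_finite_set_def
proof (intro allI)
  fix a b
  have "{x. x + p \<in> B} \<inter> {a..b} \<subseteq> (\<lambda>x. x - p) ` (B \<inter> {a + p..b + p})"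
    by (force simp: image_iff)
  then show "finite ({x. x + p \<in> B} \<inter> {a..b})"
    using assms finite_surj unfolding locally_finite_set_def by blast
qed

lemma locally_finite_set_vimage_reflect:
  assumes "locally_finite_set B"
  shows "locally_finite_set {x. p - x \<in> B}"
  unfolding locally_finite_set_def
proof (intro allI)
  fix a b
  have "{x. p - x \<in> B} \<inter> {a..b} \<subseteq> (\<lambda>x. p - x) ` (B \<inter> {p - b..p - a})"
    by (force simp: image_iff)
  then show "finite ({x. p - x \<in> B} \<inter> {a..b})"
    using assms finite_surj unfolding locally_finite_set_def by blast
qed

lemma locally_finite_set_eventually:
  assumes "locally_finite_set B"
  shows "eventually (\<lambda>y. y \<notin> B) (at x)"
proof -
  let ?F = "B \<inter> {x - 1..x + 1} - {x}"
  have "finite ?F"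
    using assms by (auto simp: locally_finite_set_def)
  then have "open ({x - 1<..<x + 1} - ?F)"
    by (intro open_Diff finite_imp_closed) auto
  then show ?thesis
    unfolding eventually_at_topological
    by (intro exI[of _ "{x - 1<..<x + 1} - ?F"]) auto
qed

lemma weight_bound: "weight M f \<Longrightarrow> norm (f x) \<le> M"
  by (simp add: weight_def)

lemma weight_nonneg: "weight M f \<Longrightarrow> 0 \<le> M"
  using weight_bound norm_ge_zero order_trans by blast

lemma weight_const: "norm c \<le> M \<Longrightarrow> weight M (\<lambda>x. c)"
  using locally_finite_set_empty by (auto simp: weight_def)

text \<open>Off finitely many points the product is continuous, hence Borel measurable, and it is
  bounded on \<open>{a..b}\<close>; so it is Lebesgue integrable there, and the finite exceptional
  set is negligible.\<close>

lemma weight_times_continuous_integrable: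
  assumes "weight M f" and g: "continuous_on UNIV g"
  shows "locally_integrable (\<lambda>x. f x * g x)"
  unfolding locally_integrable_def
proof (intro allI)
  fix a b :: real
  let ?h = "\<lambda>x. f x * g x"
  obtain B where B: "locally_finite_set B" and cont: "\<And>x. x \<notin> B \<Longrightarrow> isCont f x"
    using assms(1) by (auto simp: weight_def)
  let ?F = "B \<inter> {a..b}" and ?S = "{a..b} - B \<inter> {a..b}"
  have fin: "finite ?F"
    using B by (simp add: locally_finite_set_def)
  have "compact (g ` {a..b})"
    using g by (intro compact_continuous_image) (auto intro: continuous_on_subset)
  then obtain K where K: "\<And>x. x \<in> {a..b} \<Longrightarrow> norm (g x) \<le> K"
    by (meson bounded_iff compact_imp_bounded imageI)
  have contS: "continuous_on ?S ?h"
  proof (rule continuous_on_mult)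
    show "continuous_on ?S f"
      using cont by (intro continuous_at_imp_continuous_on) auto
    show "continuous_on ?S g"
      using g continuous_on_subset by blast
  qed
  have Sb: "?S \<in> sets borel"
    using fin by (intro sets.Diff) (auto intro: finite_imp_closed borel_closed)
  have "set_integrable lborel ?S ?h"
    unfolding set_integrable_def
  proof (rule integrableI_bounded_set[where A = "?S" and B = "M * K"])
    show "?S \<in> sets lborel"
      using Sb by simp
    show "(\<lambda>x. indicator ?S x *\<^sub>R ?h x) \<in> borel_measurable lborel"
      using borel_measurable_continuous_on_indicator[OF Sb contS] by simp
    have "emeasure lborel ?S \<le> emeasure lborel {a..b}"
      by (rule emeasure_mono) auto
    then show "emeasure lborel ?S < \<infinity>"
      using emeasure_lborel_Icc_eq[of a b] by (simp add: le_less_trans split: if_splits)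
    show "AE x\<in>?S in lborel. norm (indicator ?S x *\<^sub>R ?h x) \<le> M * K"
      using K weight_bound[OF assms(1)] weight_nonneg[OF assms(1)]
      by (intro AE_I2 impI) (auto simp: norm_mult simp del: Diff_iff intro!: mult_mono)
  qed auto
  then have "?h integrable_on ?S"
    by (rule set_borel_integral_eq_integral)
  then show "?h integrable_on {a..b}"
    by (rule integrable_spike_set) (auto intro: negligible_subset[OF negligible_finite[OF fin]])
qed

text \<open>The oriented integral from \<open>x0\<close> to \<open>x\<close>: one of the two
  intervals is always empty or a single point, and its integral vanishes.\<close>

definition primitive_from :: "real \<Rightarrow> (real \<Rightarrow> complex) \<Rightarrow> real \<Rightarrow> complex" where
  "primitive_from x0 f x = integral {x0..x} f - integral {x..x0} f"

text \<open>A base point \<open>c\<close> to the left of both points makes the standard facts on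
  indefinite integrals applicable around any point, \<open>x0\<close> included.\<close>

lemma primitive_from_eq:
  assumes f: "locally_integrable f" and c: "c \<le> x0" "c \<le> x"
  shows "primitive_from x0 f x = integral {c..x} f - integral {c..x0} f"
proof (cases "x0 \<le> x")
  case True
  have "integral {c..x0} f + integral {x0..x} f = integral {c..x} f"
    using True c f by (intro Henstock_Kurzweil_Integration.integral_combine)
      (auto simp: locally_integrable_def)
  moreover have "integral {x..x0} f = 0"
    using True by (cases "x = x0") auto
  ultimately show ?thesis
    by (simp add: primitive_from_def algebra_simps)
next
  case False
  have "integral {c..x} f + integral {x..x0} f = integral {c..x0} f"
    using False c f by (intro Henstock_Kurzweil_Integration.integral_combine)
      (auto simp: locally_integrable_def)
  moreover have "integral {x0..x} f = 0"
    using False by auto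
  ultimately show ?thesis
    by (simp add: primitive_from_def algebra_simps)
qed

lemma primitive_from_self [simp]: "primitive_from x0 f x0 = 0"
  by (simp add: primitive_from_def)

lemma continuous_primitive_from:
  assumes f: "locally_integrable f"
  shows "continuous_on UNIV (primitive_from x0 f)"
proof (rule continuous_at_imp_continuous_on, rule ballI)
  fix x :: real
  let ?c = "min x0 x - 1"
  have "continuous_on {?c..x + 1} (\<lambda>x. integral {?c..x} f - integral {?c..x0} f)"
    using f by (intro continuous_intros indefinite_integral_continuous_1)
      (auto simp: locally_integrable_def)
  then have "continuous_on {?c<..<x + 1} (\<lambda>x. integral {?c..x} f - integral {?c..x0} f)"
    by (rule continuous_on_subset) auto
  then have "continuous_on {?c<..<x + 1} (primitive_from x0 f)"
    by (subst continuous_on_cong[OF refl primitive_from_eq[OF f]]) auto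
  then show "isCont (primitive_from x0 f) x"
    by (simp add: continuous_on_eq_continuous_at)
qed

lemma primitive_from_has_vector_derivative:
  assumes f: "locally_integrable f" and x: "isCont f x"
  shows "(primitive_from x0 f has_vector_derivative f x) (at x)"
proof -
  let ?c = "min x0 x - 1"
  have "((\<lambda>u. integral {?c..u} f) has_vector_derivative f x) (at x within ({?c..x + 1} - {}))"
    using f x by (intro integral_has_vector_derivative_continuous_at)
      (auto simp: locally_integrable_def intro: continuous_at_imp_continuous_at_within)
  then have "((\<lambda>u. integral {?c..u} f) has_vector_derivative f x) (at x)"
    by (simp add: at_within_Icc_at)
  then have "((\<lambda>u. integral {?c..u} f - integral {?c..x0} f) has_vector_derivative f x) (at x)"
    by (auto intro: derivative_eq_intros)
  then show ?thesis
    by (rule has_vector_derivative_transform_within_open[where S = "{?c<..<x + 1}"])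
      (auto intro!: primitive_from_eq[OF f, symmetric])
qed

lemma has_integral_power_right:
  fixes a b :: real
  assumes "a \<le> b"
  shows "((\<lambda>t. K * \<bar>t - a\<bar> ^ n) has_integral K * (b - a) ^ Suc n / Suc n) {a..b}"
proof -
  have "((\<lambda>t. K * (t - a) ^ n) has_integral
      K * (b - a) ^ Suc n / Suc n - K * (a - a) ^ Suc n / Suc n) {a..b}"
  proof (rule fundamental_theorem_of_calculus[OF assms])
    fix t
    have "((\<lambda>t. t - a) has_real_derivative 1) (at t within {a..b})"
      by (auto intro!: derivative_eq_intros)
    from DERIV_cmult[OF DERIV_power[OF this, of "Suc n"], of "K / Suc n"]
    have "((\<lambda>t. (K * (t - a) ^ Suc n / Suc n)) has_real_derivative K * (t - a) ^ n) (at t within {a..b})"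
      by (simp del: of_nat_Suc power_Suc)
    then show "((\<lambda>t. (K * (t - a) ^ Suc n / Suc n)) has_vector_derivative K * (t - a) ^ n) (at t within {a..b})"
      by (simp only: has_real_derivative_iff_has_vector_derivative)
  qed
  from has_integral_eq[OF _ this, of "\<lambda>t. K * \<bar>t - a\<bar> ^ n"] show ?thesis
    by (simp del: power_Suc of_nat_Suc)
qed

lemma has_integral_power_left:
  fixes a b :: real
  assumes "a \<le> b"
  shows "((\<lambda>t. K * \<bar>t - b\<bar> ^ n) has_integral K * (b - a) ^ Suc n / Suc n) {a..b}"
proof -
  have "((\<lambda>t. K * (b - t) ^ n) has_integral
      - (K * (b - b) ^ Suc n / Suc n) - - (K * (b - a) ^ Suc n / Suc n)) {a..b}"
  proof (rule fundamental_theorem_of_calculus[OF assms])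
    fix t
    have "((\<lambda>t. b - t) has_real_derivative - 1) (at t within {a..b})"
      by (auto intro!: derivative_eq_intros)
    from DERIV_cmult[OF DERIV_power[OF this, of "Suc n"], of "- K / Suc n"]
    have "((\<lambda>t. - (K * (b - t) ^ Suc n / Suc n)) has_real_derivative K * (b - t) ^ n) (at t within {a..b})"
      by (simp del: of_nat_Suc power_Suc)
    then show "((\<lambda>t. - (K * (b - t) ^ Suc n / Suc n)) has_vector_derivative K * (b - t) ^ n) (at t within {a..b})"
      by (simp only: has_real_derivative_iff_has_vector_derivative)
  qed
  from has_integral_eq[OF _ this, of "\<lambda>t. K * \<bar>t - b\<bar> ^ n"] show ?thesis
    by (simp add: abs_minus_commute[of _ b] del: power_Suc of_nat_Suc)
qed

text \<open>Each integration from \<open>x0\<close> raises the power of the distance by one and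
  divides by the new exponent; iterated, this produces the factorials that make the Picard series
  converge for every frequency.\<close>

lemma primitive_from_bound:
  assumes f: "locally_integrable f" and bound: "\<And>t. norm (f t) \<le> K * \<bar>t - x0\<bar> ^ n"
  shows "norm (primitive_from x0 f x) \<le> K * \<bar>x - x0\<bar> ^ Suc n / Suc n"
proof (cases "x0 \<le> x")
  case True
  have "norm (integral {x0..x} f) \<le> integral {x0..x} (\<lambda>t. K * \<bar>t - x0\<bar> ^ n)"
    using f has_integral_power_right[OF True, of K n]
    by (intro integral_norm_bound_integral bound) (auto simp: locally_integrable_def)
  also have "\<dots> = K * (x - x0) ^ Suc n / Suc n"
    by (rule integral_unique[OF has_integral_power_right[OF True]])
  finally have "norm (integral {x0..x} f) \<le> K * (x - x0) ^ Suc n / Suc n" .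
  moreover have "integral {x..x0} f = 0"
    using True by (cases "x = x0") auto
  ultimately show ?thesis
    using True by (simp add: primitive_from_def del: power_Suc of_nat_Suc)
next
  case False
  then have le: "x \<le> x0" by simp
  have "norm (integral {x..x0} f) \<le> integral {x..x0} (\<lambda>t. K * \<bar>t - x0\<bar> ^ n)"
    using f has_integral_power_left[OF le, of K n]
    by (intro integral_norm_bound_integral bound) (auto simp: locally_integrable_def)
  also have "\<dots> = K * (x0 - x) ^ Suc n / Suc n"
    by (rule integral_unique[OF has_integral_power_left[OF le]])
  finally have "norm (integral {x..x0} f) \<le> K * (x0 - x) ^ Suc n / Suc n" .
  then show ?thesis
    using False by (simp add: primitive_from_def del: power_Suc of_nat_Suc)
qed

lemma primitive_from_sum:
  assumes "\<And>n. locally_integrable (f n)"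
  shows "primitive_from x0 (\<lambda>t. \<Sum>n<N. c n * f n t) x = (\<Sum>n<(N::nat). c n * primitive_from x0 (f n) x)"
proof -
  have "integral {a..b} (\<lambda>t. \<Sum>n<N. c n * f n t) = (\<Sum>n<N. c n * integral {a..b} (f n))" for a b
    using assms by (subst integral_sum)
      (auto simp: locally_integrable_def intro!: integrable_on_mult_right)
  then show ?thesis
    by (simp add: primitive_from_def sum_subtractf right_diff_distrib)
qed

lemma primitive_from_diff:
  assumes "locally_integrable f" "locally_integrable g"
  shows "primitive_from x0 f x - primitive_from x0 g x = primitive_from x0 (\<lambda>t. f t - g t) x"
  using assms by (simp add: primitive_from_def locally_integrable_def integral_diff algebra_simps)

lemma locally_integrable_diff:
  assumes "locally_integrable f" "locally_integrable g"
  shows "locally_integrable (\<lambda>t. f t - g t)"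
  using assms by (simp add: locally_integrable_def integrable_diff)

section \<open>Picard iteration\<close>

text \<open>The nested integral of 1 with weights \<alpha>, \<beta>, \<alpha>, ... from the outside
  in. The weights are swapped in the recursive call because the derivative of \<open>u\<close>
  involves \<open>v\<close>, and the derivative of \<open>v\<close> involves \<open>u\<close>, each
  with its own coefficient.\<close>

fun iterated_primitive ::
    "real \<Rightarrow> (real \<Rightarrow> complex) \<Rightarrow> (real \<Rightarrow> complex) \<Rightarrow> nat \<Rightarrow> real \<Rightarrow> complex" where
  "iterated_primitive x0 \<alpha> \<beta> 0 = (\<lambda>x. 1)"
| "iterated_primitive x0 \<alpha> \<beta> (Suc n) =
     primitive_from x0 (\<lambda>t. \<alpha> t * iterated_primitive x0 \<beta> \<alpha> n t)"

text \<open>The two claims feed each other: a primitive is continuous because its integrand is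
  integrable, and the next integrand is integrable because the primitive is continuous.\<close>

lemma iterated_primitive_integrable_continuous:
  assumes "weight M \<alpha>" "weight M \<beta>"
  shows "locally_integrable (\<lambda>t. \<alpha> t * iterated_primitive x0 \<beta> \<alpha> n t) \<and>
         continuous_on UNIV (iterated_primitive x0 \<alpha> \<beta> n)"
  using assms
proof (induction n arbitrary: \<alpha> \<beta>)
  case 0
  then show ?case
    using weight_times_continuous_integrable[where g = "\<lambda>t. 1"] by fastforce
next
  case (Suc n)
  have "continuous_on UNIV (iterated_primitive x0 a b (Suc n))" if "weight M a" "weight M b" for a b
    using Suc.IH[OF that] continuous_primitive_from by simp
  then show ?case
    using Suc.prems weight_times_continuous_integrable by blast
qed

lemmas iterated_primitive_integrable =
  iterated_primitive_integrable_continuous[THEN conjunct1]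

lemma iterated_primitive_bound:
  assumes "weight M \<alpha>" "weight M \<beta>"
  shows "norm (iterated_primitive x0 \<alpha> \<beta> n x) \<le> M ^ n * \<bar>x - x0\<bar> ^ n / fact n"
  using assms
proof (induction n arbitrary: \<alpha> \<beta> x)
  case 0
  then show ?case by simp
next
  case (Suc n)
  have "norm (\<alpha> t * iterated_primitive x0 \<beta> \<alpha> n t) \<le> (M ^ Suc n / fact n) * \<bar>t - x0\<bar> ^ n" for t
  proof -
    have "norm (\<alpha> t * iterated_primitive x0 \<beta> \<alpha> n t) \<le> M * (M ^ n * \<bar>t - x0\<bar> ^ n / fact n)"
      unfolding norm_mult using Suc.IH[OF Suc.prems(2,1)] weight_bound[OF Suc.prems(1)]
        weight_nonneg[OF Suc.prems(1)] by (intro mult_mono) auto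
    then show ?thesis by simp
  qed
  from primitive_from_bound[OF iterated_primitive_integrable[OF Suc.prems] this]
  show ?case
    by (simp add: field_simps)
qed

text \<open>By the product rule for differences, each of the n weights is exchanged once at the cost
  of \<eta>, while the other n - 1 weights are bounded by \<open>M\<close>; hence the factor n. The
  assumption \<open>1 \<le> M\<close> allows \<open>M ^ n\<close> in place of
  \<open>M ^ (n - 1)\<close>.\<close>

lemma iterated_primitive_diff_bound:
  assumes "weight M \<alpha>" "weight M \<beta>" "weight M \<alpha>'" "weight M \<beta>'" "1 \<le> M"
    and "\<And>x. norm (\<alpha>' x - \<alpha> x) \<le> \<eta>" "\<And>x. norm (\<beta>' x - \<beta> x) \<le> \<eta>"
  shows "norm (iterated_primitive x0 \<alpha>' \<beta>' n x - iterated_primitive x0 \<alpha> \<beta> n x)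
    \<le> \<eta> * (n * M ^ n * \<bar>x - x0\<bar> ^ n / fact n)"
  using assms
proof (induction n arbitrary: \<alpha> \<beta> \<alpha>' \<beta>' x)
  case 0
  then show ?case by simp
next
  case (Suc n)
  let ?J = "iterated_primitive x0 \<beta> \<alpha> n" and ?J' = "iterated_primitive x0 \<beta>' \<alpha>' n"
  let ?f = "\<lambda>t. \<alpha> t * ?J t" and ?f' = "\<lambda>t. \<alpha>' t * ?J' t"
  note int = iterated_primitive_integrable[OF Suc.prems(1,2), of x0 n]
    iterated_primitive_integrable[OF Suc.prems(3,4), of x0 n]
  have eta: "0 \<le> \<eta>"
    using Suc.prems(6) norm_ge_zero order_trans by blast
  have "norm (?f' t - ?f t) \<le> (\<eta> * (real (Suc n) * M ^ Suc n / fact n)) * \<bar>t - x0\<bar> ^ n" for t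
  proof -
    let ?P = "M ^ n * \<bar>t - x0\<bar> ^ n / fact n"
    have P: "0 \<le> ?P"
      using Suc.prems(5) by simp
    have "norm (?f' t - ?f t) = norm ((\<alpha>' t - \<alpha> t) * ?J' t + \<alpha> t * (?J' t - ?J t))"
      by (simp add: algebra_simps)
    also have "\<dots> \<le> norm (\<alpha>' t - \<alpha> t) * norm (?J' t) + norm (\<alpha> t) * norm (?J' t - ?J t)"
      by (metis norm_mult norm_triangle_ineq)
    also have "\<dots> \<le> \<eta> * ?P + M * (\<eta> * (n * M ^ n * \<bar>t - x0\<bar> ^ n / fact n))"
      using Suc.IH[OF Suc.prems(2,1,4,3,5,7,6)] Suc.prems(6)
        iterated_primitive_bound[OF Suc.prems(4,3)] weight_bound[OF Suc.prems(1)] eta Suc.prems(5)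
      by (intro add_mono mult_mono) auto
    also have "\<eta> * ?P \<le> M * (\<eta> * ?P)"
      using mult_right_mono[OF Suc.prems(5) mult_nonneg_nonneg[OF eta P]] by simp
    finally show ?thesis
      by (simp add: field_simps)
  qed
  from primitive_from_bound[OF locally_integrable_diff[OF int(2,1)] this]
  show ?case
    unfolding iterated_primitive.simps primitive_from_diff[OF int(2,1)]
    by (simp add: field_simps del: of_nat_Suc power_Suc)
qed

definition geometric_growth :: "(nat \<Rightarrow> complex) \<Rightarrow> bool" where
  "geometric_growth c \<longleftrightarrow> (\<exists>K R. 0 \<le> R \<and> (\<forall>n. norm (c n) \<le> K * R ^ n))"

lemma geometric_growth_Suc:
  assumes "geometric_growth c"
  shows "geometric_growth (c \<circ> Suc)"
proof -
  obtain K R where "0 \<le> R" "\<And>n. norm (c n) \<le> K * R ^ n"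
    using assms by (auto simp: geometric_growth_def)
  then have "norm ((c \<circ> Suc) n) \<le> (K * R) * R ^ n" for n
    by (metis comp_apply mult.assoc power_Suc)
  then show ?thesis
    using \<open>0 \<le> R\<close> unfolding geometric_growth_def by blast
qed

text \<open>The Picard series with free coefficients: differentiation shifts them and swaps the
  weights, so one definition covers all four components of the fundamental system.\<close>

definition iterated_series ::
    "real \<Rightarrow> (nat \<Rightarrow> complex) \<Rightarrow> (real \<Rightarrow> complex) \<Rightarrow> (real \<Rightarrow> complex) \<Rightarrow> real \<Rightarrow> complex" where
  "iterated_series x0 c \<alpha> \<beta> x = (\<Sum>n. c n * iterated_primitive x0 \<alpha> \<beta> n x)"

lemma iterated_series_dominated:
  assumes "weight M \<alpha>" "weight M \<beta>" "geometric_growth c"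
  obtains T :: "nat \<Rightarrow> real" where "summable T"
    "\<And>n x. \<bar>x - x0\<bar> \<le> r \<Longrightarrow> norm (c n * iterated_primitive x0 \<alpha> \<beta> n x) \<le> T n"
proof -
  obtain K R where R: "0 \<le> R" and K: "\<And>n. norm (c n) \<le> K * R ^ n"
    using assms(3) by (auto simp: geometric_growth_def)
  have M: "0 \<le> M"
    using weight_nonneg assms(1) .
  have "summable (\<lambda>n. K * (inverse (fact n) * (R * M * r) ^ n))"
    by (intro summable_mult summable_exp)
  moreover have "norm (c n * iterated_primitive x0 \<alpha> \<beta> n x) \<le> K * (inverse (fact n) * (R * M * r) ^ n)"
    if "\<bar>x - x0\<bar> \<le> r" for n x
  proof -
    have "norm (iterated_primitive x0 \<alpha> \<beta> n x) \<le> M ^ n * \<bar>x - x0\<bar> ^ n / fact n"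
      by (rule iterated_primitive_bound[OF assms(1,2)])
    also have "\<dots> \<le> M ^ n * r ^ n / fact n"
      using that M by (intro divide_right_mono mult_left_mono power_mono) auto
    finally have "norm (c n * iterated_primitive x0 \<alpha> \<beta> n x) \<le> (K * R ^ n) * (M ^ n * r ^ n / fact n)"
      unfolding norm_mult using K[of n] by (intro mult_mono) (auto intro: order_trans[OF norm_ge_zero])
    then show ?thesis
      by (simp add: field_simps power_mult_distrib)
  qed
  ultimately show ?thesis
    using that by blast
qed

lemma iterated_series_summable:
  assumes "weight M \<alpha>" "weight M \<beta>" "geometric_growth c"
  shows "summable (\<lambda>n. c n * iterated_primitive x0 \<alpha> \<beta> n x)"
proof -
  obtain T where "summable T"
    "\<And>n y. \<bar>y - x0\<bar> \<le> \<bar>x - x0\<bar> \<Longrightarrow> norm (c n * iterated_primitive x0 \<alpha> \<beta> n y) \<le> T n"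
    using iterated_series_dominated[OF assms] by metis
  then show ?thesis
    by (rule summable_comparison_test'[where N = 0]) simp
qed

text \<open>Termwise integration: on a bounded interval the partial sums are dominated by a
  constant, so dominated convergence moves the integral past the limit. The series thus solves an
  integral equation with initial value \<open>c 0\<close>.\<close>

lemma
  assumes \<alpha>: "weight M \<alpha>" and \<beta>: "weight M \<beta>" and c: "geometric_growth c"
  shows iterated_series_eq: "iterated_series x0 c \<alpha> \<beta> x =
      c 0 + primitive_from x0 (\<lambda>t. \<alpha> t * iterated_series x0 (c \<circ> Suc) \<beta> \<alpha> t) x"
    and iterated_series_integrable:
      "locally_integrable (\<lambda>t. \<alpha> t * iterated_series x0 (c \<circ> Suc) \<beta> \<alpha> t)"
proof -
  let ?f = "\<lambda>n t. \<alpha> t * iterated_primitive x0 \<beta> \<alpha> n t"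
  let ?h = "\<lambda>N t. \<Sum>n<N. c (Suc n) * ?f n t"
  let ?g = "\<lambda>t. \<alpha> t * iterated_series x0 (c \<circ> Suc) \<beta> \<alpha> t"
  note int = iterated_primitive_integrable[OF \<alpha> \<beta>, of x0]
  have h: "?h N t = \<alpha> t * (\<Sum>n<N. (c \<circ> Suc) n * iterated_primitive x0 \<beta> \<alpha> n t)" for N t
    by (simp add: sum_distrib_left algebra_simps)
  have conv: "?g integrable_on {a..b} \<and>
      (\<lambda>N. integral {a..b} (?h N)) \<longlonglongrightarrow> integral {a..b} ?g" for a b
  proof -
    obtain T where T: "summable T"
      "\<And>n y. \<bar>y - x0\<bar> \<le> \<bar>a - x0\<bar> + \<bar>b - x0\<bar> \<Longrightarrow>
        norm ((c \<circ> Suc) n * iterated_primitive x0 \<beta> \<alpha> n y) \<le> T n"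
      using iterated_series_dominated[OF \<beta> \<alpha> geometric_growth_Suc[OF c]] by metis
    have T0: "0 \<le> T n" for n
      by (rule order_trans[OF norm_ge_zero T(2)[of a]]) simp
    have "norm (?h N t) \<le> M * suminf T" if "t \<in> {a..b}" for N t
      unfolding h norm_mult
    proof (rule mult_mono)
      have t: "\<bar>t - x0\<bar> \<le> \<bar>a - x0\<bar> + \<bar>b - x0\<bar>"
        using that by auto
      have "norm (\<Sum>n<N. (c \<circ> Suc) n * iterated_primitive x0 \<beta> \<alpha> n t) \<le> (\<Sum>n<N. T n)"
        by (intro sum_norm_le T(2)[OF t])
      also have "\<dots> \<le> suminf T"
        using T(1) T0 by (intro sum_le_suminf) auto
      finally show "norm (\<Sum>n<N. (c \<circ> Suc) n * iterated_primitive x0 \<beta> \<alpha> n t) \<le> suminf T" .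
    qed (use weight_bound[OF \<alpha>] weight_nonneg[OF \<alpha>] in auto)
    moreover have "(\<lambda>N. ?h N t) \<longlonglongrightarrow> ?g t" for t
      unfolding h iterated_series_def
      by (intro tendsto_mult tendsto_const summable_LIMSEQ iterated_series_summable[OF \<beta> \<alpha>]
          geometric_growth_Suc[OF c])
    moreover have "?h N integrable_on {a..b}" for N
      using int by (auto simp: locally_integrable_def intro!: integrable_sum integrable_on_mult_right)
    ultimately show ?thesis
      using dominated_convergence[of ?h "{a..b}" "\<lambda>_. M * suminf T" ?g] integrable_const_ivl by blast
  qed
  then show "locally_integrable ?g"
    by (simp add: locally_integrable_def)
  have "(\<lambda>N. primitive_from x0 (?h N) x) \<longlonglongrightarrow> primitive_from x0 ?g x"
    unfolding primitive_from_def using conv by (intro tendsto_diff) auto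
  then have "(\<lambda>n. c (Suc n) * iterated_primitive x0 \<alpha> \<beta> (Suc n) x) sums primitive_from x0 ?g x"
    unfolding sums_def primitive_from_sum[OF int] by simp
  from sums_Suc[OF this] show "iterated_series x0 c \<alpha> \<beta> x = c 0 + primitive_from x0 ?g x"
    by (simp add: iterated_series_def sums_iff add.commute)
qed

lemma iterated_series_continuous:
  assumes "weight M \<alpha>" "weight M \<beta>" "geometric_growth c"
  shows "continuous_on UNIV (iterated_series x0 c \<alpha> \<beta>)"
proof -
  have "continuous_on UNIV
      (\<lambda>x. c 0 + primitive_from x0 (\<lambda>t. \<alpha> t * iterated_series x0 (c \<circ> Suc) \<beta> \<alpha> t) x)"
    by (intro continuous_intros continuous_primitive_from iterated_series_integrable[OF assms])
  then show ?thesis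
    using iterated_series_eq[OF assms, of x0] by presburger
qed

lemma iterated_series_base:
  assumes "weight M \<alpha>" "weight M \<beta>" "geometric_growth c"
  shows "iterated_series x0 c \<alpha> \<beta> x0 = c 0"
  by (simp add: iterated_series_eq[OF assms])

lemma iterated_series_has_vector_derivative:
  assumes "weight M \<alpha>" "weight M \<beta>" "geometric_growth c" "isCont \<alpha> x"
  shows "(iterated_series x0 c \<alpha> \<beta> has_vector_derivative
    \<alpha> x * iterated_series x0 (c \<circ> Suc) \<beta> \<alpha> x) (at x)"
proof -
  let ?g = "\<lambda>t. \<alpha> t * iterated_series x0 (c \<circ> Suc) \<beta> \<alpha> t"
  have "isCont (iterated_series x0 (c \<circ> Suc) \<beta> \<alpha>) x"
    using iterated_series_continuous[OF assms(2,1) geometric_growth_Suc[OF assms(3)]]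
    by (simp add: continuous_on_eq_continuous_at)
  then have "(primitive_from x0 ?g has_vector_derivative ?g x) (at x)"
    using assms(4) by (intro primitive_from_has_vector_derivative
        iterated_series_integrable[OF assms(1-3)] isCont_mult)
  then have "((\<lambda>x. c 0 + primitive_from x0 ?g x) has_vector_derivative ?g x) (at x)"
    by (auto intro: derivative_eq_intros)
  then show ?thesis
    using iterated_series_eq[OF assms(1-3), of x0] by presburger
qed

section \<open>The first-order system and its transfer matrix\<close>

text \<open>The first-order system for \<open>u\<close> and its flux. The exceptional set is
  existentially quantified because it changes under the operations below: sums take unions,
  translations and reflections move it.\<close>

definition ode_solution ::
    "(real \<Rightarrow> complex) \<Rightarrow> complex \<Rightarrow> (real \<Rightarrow> complex) \<Rightarrow> (real \<Rightarrow> complex) \<Rightarrow> bool" where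
  "ode_solution eps k u v \<longleftrightarrow> continuous_on UNIV u \<and> continuous_on UNIV v \<and>
     (\<exists>B. locally_finite_set B \<and> (\<forall>x. x \<notin> B \<longrightarrow>
        (u has_vector_derivative eps x * v x) (at x) \<and> (v has_vector_derivative k * u x) (at x)))"

lemma constant_if_derivative_zero:
  fixes w :: "real \<Rightarrow> complex"
  assumes "locally_finite_set B" "continuous_on UNIV w"
    and "\<And>x. x \<notin> B \<Longrightarrow> (w has_vector_derivative 0) (at x)"
  shows "w x = w y"
proof -
  have *: "w b = w a" if "a \<le> b" for a b
  proof (rule has_derivative_zero_unique_strong_interval[of "B \<inter> {a..b}" a b w])
    show "finite (B \<inter> {a..b})"
      using assms(1) by (simp add: locally_finite_set_def)
    show "continuous_on {a..b} w"
      using assms(2) continuous_on_subset by blast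
    show "(w has_derivative (\<lambda>h. 0)) (at x within {a..b})" if "x \<in> {a..b} - B \<inter> {a..b}" for x
      using assms(3)[of x] that by (auto simp: has_vector_derivative_def intro: has_derivative_at_withinI)
  qed (use that in auto)
  show ?thesis
    using *[of x y] *[of y x] by (cases "x \<le> y") auto
qed

text \<open>The coefficient matrix with rows (0, eps) and (k, 0) has trace zero, and all functions
  involved are continuous across the exceptional points. In what follows this takes the place of a
  uniqueness theorem for initial value problems.\<close>

lemma wronskian_constant:
  assumes "ode_solution eps k u v" "ode_solution eps k u' v'"
  shows "u x * v' x - v x * u' x = u y * v' y - v y * u' y"
proof -
  obtain B where B: "locally_finite_set B" "\<And>x. x \<notin> B \<Longrightarrow> (u has_vector_derivative eps x * v x) (at x)"
    "\<And>x. x \<notin> B \<Longrightarrow> (v has_vector_derivative k * u x) (at x)"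
    using assms(1) by (auto simp: ode_solution_def)
  obtain C where C: "locally_finite_set C" "\<And>x. x \<notin> C \<Longrightarrow> (u' has_vector_derivative eps x * v' x) (at x)"
    "\<And>x. x \<notin> C \<Longrightarrow> (v' has_vector_derivative k * u' x) (at x)"
    using assms(2) by (auto simp: ode_solution_def)
  show ?thesis
  proof (rule constant_if_derivative_zero[OF locally_finite_set_Un[OF B(1) C(1)]])
    show "continuous_on UNIV (\<lambda>x. u x * v' x - v x * u' x)"
      using assms by (auto simp: ode_solution_def intro!: continuous_intros)
    show "((\<lambda>x. u x * v' x - v x * u' x) has_vector_derivative 0) (at x)" if "x \<notin> B \<union> C" for x
    proof -
      have "((\<lambda>x. u x * v' x - v x * u' x) has_vector_derivative
          (u x * (k * u' x) + eps x * v x * v' x) - (v x * (eps x * v' x) + k * u x * u' x)) (at x)"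
        using B C that
        by (intro has_vector_derivative_diff has_vector_derivative_mult) auto
      then show ?thesis
        by (simp add: algebra_simps)
    qed
  qed
qed

lemma ode_solution_combination:
  assumes "ode_solution eps k u v" "ode_solution eps k u' v'"
  shows "ode_solution eps k (\<lambda>x. p * u x + q * u' x) (\<lambda>x. p * v x + q * v' x)"
proof -
  obtain B where B: "locally_finite_set B" "\<And>x. x \<notin> B \<Longrightarrow> (u has_vector_derivative eps x * v x) (at x)"
    "\<And>x. x \<notin> B \<Longrightarrow> (v has_vector_derivative k * u x) (at x)"
    using assms(1) by (auto simp: ode_solution_def)
  obtain C where C: "locally_finite_set C" "\<And>x. x \<notin> C \<Longrightarrow> (u' has_vector_derivative eps x * v' x) (at x)"
    "\<And>x. x \<notin> C \<Longrightarrow> (v' has_vector_derivative k * u' x) (at x)"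
    using assms(2) by (auto simp: ode_solution_def)
  have "((\<lambda>x. p * u x + q * u' x) has_vector_derivative eps x * (p * v x + q * v' x)) (at x) \<and>
      ((\<lambda>x. p * v x + q * v' x) has_vector_derivative k * (p * u x + q * u' x)) (at x)"
    if "x \<notin> B \<union> C" for x
  proof -
    have "((\<lambda>x. p * u x + q * u' x) has_vector_derivative p * (eps x * v x) + q * (eps x * v' x)) (at x)"
      "((\<lambda>x. p * v x + q * v' x) has_vector_derivative p * (k * u x) + q * (k * u' x)) (at x)"
      using B C that
      by (auto intro!: has_vector_derivative_add has_vector_derivative_mult_right)
    then show ?thesis
      by (simp add: algebra_simps)
  qed
  then show ?thesis
    using assms locally_finite_set_Un[OF B(1) C(1)] unfolding ode_solution_def
    by (auto intro!: continuous_intros exI[of _ "B \<union> C"])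
qed

lemma ode_solution_translate:
  assumes "ode_solution eps k u v" and per: "\<And>x. eps (x + p) = eps x"
  shows "ode_solution eps k (\<lambda>x. u (x + p)) (\<lambda>x. v (x + p))"
proof -
  obtain B where B: "locally_finite_set B" "\<And>x. x \<notin> B \<Longrightarrow> (u has_vector_derivative eps x * v x) (at x)"
    "\<And>x. x \<notin> B \<Longrightarrow> (v has_vector_derivative k * u x) (at x)"
    using assms(1) by (auto simp: ode_solution_def)
  have chain: "((\<lambda>x. f (x + p)) has_vector_derivative D) (at x)"
    if "(f has_vector_derivative D) (at (x + p))" for f :: "real \<Rightarrow> complex" and D x
  proof -
    have "((\<lambda>x. x + p) has_vector_derivative 1) (at x)"
      by (auto intro: derivative_eq_intros)
    from vector_diff_chain_at[OF this that] show ?thesis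
      by (simp add: o_def)
  qed
  have "continuous_on UNIV (\<lambda>x. f (x + p))" if "continuous_on UNIV f" for f :: "real \<Rightarrow> complex"
    by (rule continuous_on_compose2[OF that]) (auto intro!: continuous_intros)
  moreover have "((\<lambda>x. u (x + p)) has_vector_derivative eps x * v (x + p)) (at x) \<and>
      ((\<lambda>x. v (x + p)) has_vector_derivative k * u (x + p)) (at x)" if "x \<notin> {x. x + p \<in> B}" for x
    using that B(2,3)[of "x + p"] by (auto simp: per intro!: chain)
  ultimately show ?thesis
    using assms(1) locally_finite_set_vimage_translate[OF B(1), of p]
    unfolding ode_solution_def by blast
qed

text \<open>Reflection reverses the sign of derivatives, so the flux must change its sign for the
  pair to solve the same system again.\<close>

lemma ode_solution_reflect:
  assumes "ode_solution eps k u v" and sym: "\<And>x. eps (p - x) = eps x"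
  shows "ode_solution eps k (\<lambda>x. u (p - x)) (\<lambda>x. - v (p - x))"
proof -
  obtain B where B: "locally_finite_set B" "\<And>x. x \<notin> B \<Longrightarrow> (u has_vector_derivative eps x * v x) (at x)"
    "\<And>x. x \<notin> B \<Longrightarrow> (v has_vector_derivative k * u x) (at x)"
    using assms(1) by (auto simp: ode_solution_def)
  have chain: "((\<lambda>x. f (p - x)) has_vector_derivative - D) (at x)"
    if "(f has_vector_derivative D) (at (p - x))" for f :: "real \<Rightarrow> complex" and D x
  proof -
    have "((\<lambda>x. p - x) has_vector_derivative - 1) (at x)"
      by (auto intro: derivative_eq_intros)
    from vector_diff_chain_at[OF this that] show ?thesis
      by (simp add: o_def)
  qed
  have "continuous_on UNIV (\<lambda>x. f (p - x))" if "continuous_on UNIV f" for f :: "real \<Rightarrow> complex"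
    by (rule continuous_on_compose2[OF that]) (auto intro!: continuous_intros)
  moreover have "((\<lambda>x. u (p - x)) has_vector_derivative eps x * - v (p - x)) (at x) \<and>
      ((\<lambda>x. - v (p - x)) has_vector_derivative k * u (p - x)) (at x)" if "x \<notin> {x. p - x \<in> B}" for x
  proof -
    have "(u has_vector_derivative eps x * v (p - x)) (at (p - x))"
      "(v has_vector_derivative k * u (p - x)) (at (p - x))"
      using that B(2,3)[of "p - x"] sym[of x] by auto
    from chain[OF this(1)] has_vector_derivative_minus[OF chain[OF this(2)]] show ?thesis
      by simp
  qed
  ultimately show ?thesis
    using assms(1) locally_finite_set_vimage_reflect[OF B(1), of p] continuous_on_minus
    unfolding ode_solution_def by blast
qed

section \<open>Fundamental solutions as power series in the frequency\<close>

definition even_powers :: "complex \<Rightarrow> nat \<Rightarrow> complex" where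
  "even_powers \<omega> n = (if even n then \<omega> ^ n else 0)"

text \<open>Under the substitution v = \<omega> w, the data (0, 1) for (u, v) mean w = 1 / \<omega>
  at \<open>x0\<close>; hence one power of \<omega> is missing, and the exponent is n - 1. It is
  nonnegative for odd n, so \<omega> = 0 is covered as well.\<close>

definition odd_powers :: "complex \<Rightarrow> nat \<Rightarrow> complex" where
  "odd_powers \<omega> n = (if odd n then \<omega> ^ (n - 1) else 0)"

lemma even_powers_bound: "norm (even_powers \<omega> n) \<le> (1 + norm \<omega>) ^ n"
  by (auto simp: even_powers_def norm_power intro!: power_mono)

lemma odd_powers_bound: "norm (odd_powers \<omega> n) \<le> (1 + norm \<omega>) ^ n"
proof -
  have "norm \<omega> ^ (n - 1) \<le> (1 + norm \<omega>) ^ (n - 1)"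
    by (intro power_mono) auto
  also have "\<dots> \<le> (1 + norm \<omega>) ^ n"
    by (intro power_increasing) auto
  finally show ?thesis
    by (auto simp: odd_powers_def norm_power)
qed

lemma geometric_growth_even_powers: "geometric_growth (even_powers \<omega>)"
  unfolding geometric_growth_def
  by (rule exI[of _ 1], rule exI[of _ "1 + norm \<omega>"]) (simp add: even_powers_bound)

lemma geometric_growth_odd_powers: "geometric_growth (odd_powers \<omega>)"
  unfolding geometric_growth_def
  by (rule exI[of _ 1], rule exI[of _ "1 + norm \<omega>"]) (simp add: odd_powers_bound)

lemma odd_powers_Suc: "odd_powers \<omega> \<circ> Suc = even_powers \<omega>"
  by (auto simp: odd_powers_def even_powers_def)

lemma even_powers_Suc: "even_powers \<omega> \<circ> Suc = (\<lambda>n. \<omega>\<^sup>2 * odd_powers \<omega> n)"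
  by (rule ext) (auto simp: odd_powers_def even_powers_def power2_eq_square elim!: oddE)

text \<open>With \<open>v = \<omega> w\<close> the system \<open>u' = eps v\<close>, \<open>v' = m \<omega>\<^sup>2 u\<close> reads \<open>u' = \<omega> eps w\<close>, \<open>w' = \<omega> m u\<close>, so
  every Picard step contributes one factor \<open>\<omega>\<close>. Undoing the substitution gives the following two
  solutions \<open>(u1, v1)\<close> and \<open>(u2, v2)\<close>, starting with \<open>(1, 0)\<close> and \<open>(0, 1)\<close> at \<open>x0\<close>, as power series
  in \<open>\<omega>\<close>.\<close>

definition fund_u1 :: "real \<Rightarrow> complex \<Rightarrow> (real \<Rightarrow> complex) \<Rightarrow> complex \<Rightarrow> real \<Rightarrow> complex" where
  "fund_u1 x0 m eps \<omega> = iterated_series x0 (even_powers \<omega>) eps (\<lambda>_. m)"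

definition fund_v1 :: "real \<Rightarrow> complex \<Rightarrow> (real \<Rightarrow> complex) \<Rightarrow> complex \<Rightarrow> real \<Rightarrow> complex" where
  "fund_v1 x0 m eps \<omega> = iterated_series x0 (even_powers \<omega> \<circ> Suc) (\<lambda>_. m) eps"

definition fund_u2 :: "real \<Rightarrow> complex \<Rightarrow> (real \<Rightarrow> complex) \<Rightarrow> complex \<Rightarrow> real \<Rightarrow> complex" where
  "fund_u2 x0 m eps \<omega> = iterated_series x0 (odd_powers \<omega>) eps (\<lambda>_. m)"

definition fund_v2 :: "real \<Rightarrow> complex \<Rightarrow> (real \<Rightarrow> complex) \<Rightarrow> complex \<Rightarrow> real \<Rightarrow> complex" where
  "fund_v2 x0 m eps \<omega> = iterated_series x0 (even_powers \<omega>) (\<lambda>_. m) eps"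

lemma iterated_series_scale:
  assumes "weight M \<alpha>" "weight M \<beta>" "geometric_growth c"
  shows "iterated_series x0 (\<lambda>n. r * c n) \<alpha> \<beta> x = r * iterated_series x0 c \<alpha> \<beta> x"
  unfolding iterated_series_def
  using suminf_mult[OF iterated_series_summable[OF assms, of x0 x], of r] by (simp add: mult.assoc)

text \<open>The number \<open>m\<close> will be \<open>- mu0\<close>. Periodicity turns the
  inversion symmetry about x0 + 1/2 into a symmetry about \<open>x0\<close>, which fixes the point
  where the initial data are prescribed.\<close>

locale medium =
  fixes x0 :: real and m :: complex and eps :: "real \<Rightarrow> complex" and M :: real
  assumes weight_eps: "weight M eps"
    and weight_m: "norm m \<le> M"
    and eps_periodic: "eps (x + 1) = eps x"
    and eps_symmetric: "eps (2 * x0 - x) = eps x"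
begin

abbreviation "u1 \<equiv> fund_u1 x0 m eps"
abbreviation "v1 \<equiv> fund_v1 x0 m eps"
abbreviation "u2 \<equiv> fund_u2 x0 m eps"
abbreviation "v2 \<equiv> fund_v2 x0 m eps"

lemma weight_const_m: "weight M (\<lambda>_. m)"
  using weight_m by (rule weight_const)

lemmas growths = geometric_growth_even_powers geometric_growth_odd_powers
  geometric_growth_Suc[OF geometric_growth_even_powers]

lemma fund_continuous:
  "continuous_on UNIV (u1 \<omega>)" "continuous_on UNIV (v1 \<omega>)"
  "continuous_on UNIV (u2 \<omega>)" "continuous_on UNIV (v2 \<omega>)"
  unfolding fund_u1_def fund_v1_def fund_u2_def fund_v2_def
  using growths weight_eps weight_const_m by (auto intro: iterated_series_continuous)

lemma fund_base [simp]:
  "u1 \<omega> x0 = 1" "v1 \<omega> x0 = 0" "u2 \<omega> x0 = 0" "v2 \<omega> x0 = 1"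
  unfolding fund_u1_def fund_v1_def fund_u2_def fund_v2_def
  by (simp_all add: iterated_series_base[OF weight_eps weight_const_m]
      iterated_series_base[OF weight_const_m weight_eps] growths even_powers_def odd_powers_def)

lemma fund_u_derivative:
  assumes "isCont eps x"
  shows "(u1 \<omega> has_vector_derivative eps x * v1 \<omega> x) (at x)"
    "(u2 \<omega> has_vector_derivative eps x * v2 \<omega> x) (at x)"
  using iterated_series_has_vector_derivative[OF weight_eps weight_const_m growths(1) assms]
    iterated_series_has_vector_derivative[OF weight_eps weight_const_m growths(2) assms]
  by (simp_all add: fund_u1_def fund_v1_def fund_u2_def fund_v2_def odd_powers_Suc)

lemma fund_v_derivative:
  "(v1 \<omega> has_vector_derivative m * \<omega>\<^sup>2 * u1 \<omega> x) (at x)"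
  "(v2 \<omega> has_vector_derivative m * \<omega>\<^sup>2 * u2 \<omega> x) (at x)"
proof -
  have "(even_powers \<omega> \<circ> Suc) \<circ> Suc = (\<lambda>n. \<omega>\<^sup>2 * even_powers \<omega> n)"
    unfolding even_powers_Suc using odd_powers_Suc by (metis comp_apply)
  then show "(v1 \<omega> has_vector_derivative m * \<omega>\<^sup>2 * u1 \<omega> x) (at x)"
    using iterated_series_has_vector_derivative[OF weight_const_m weight_eps growths(3), of x x0 \<omega>]
    by (simp add: fund_u1_def fund_v1_def mult.assoc
        iterated_series_scale[OF weight_eps weight_const_m growths(1)])
  show "(v2 \<omega> has_vector_derivative m * \<omega>\<^sup>2 * u2 \<omega> x) (at x)"
    using iterated_series_has_vector_derivative[OF weight_const_m weight_eps growths(1), of x x0 \<omega>]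
    by (simp add: fund_u2_def fund_v2_def mult.assoc even_powers_Suc
        iterated_series_scale[OF weight_eps weight_const_m growths(2)])
qed

lemma fund_ode_solution:
  "ode_solution eps (m * \<omega>\<^sup>2) (u1 \<omega>) (v1 \<omega>)" "ode_solution eps (m * \<omega>\<^sup>2) (u2 \<omega>) (v2 \<omega>)"
  using weight_eps fund_continuous[of \<omega>] fund_u_derivative fund_v_derivative
  unfolding weight_def ode_solution_def by blast+

lemma fund_det: "u1 \<omega> x * v2 \<omega> x - v1 \<omega> x * u2 \<omega> x = 1"
  using wronskian_constant[OF fund_ode_solution, of \<omega> x x0] by simp

text \<open>Cramer's rule: the Wronskians with the fundamental solutions are constant, their values
  at \<open>x0\<close> are the initial data, and \<open>fund_det\<close> inverts the system. In
  particular a solution is determined by its data at \<open>x0\<close>.\<close>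

lemma ode_solution_representation:
  assumes "ode_solution eps (m * \<omega>\<^sup>2) u v"
  shows "u x = u x0 * u1 \<omega> x + v x0 * u2 \<omega> x" "v x = u x0 * v1 \<omega> x + v x0 * v2 \<omega> x"
proof -
  have 1: "u x * v2 \<omega> x - v x * u2 \<omega> x = u x0"
    using wronskian_constant[OF assms fund_ode_solution(2), of x x0] by simp
  have 2: "u1 \<omega> x * v x - v1 \<omega> x * u x = v x0"
    using wronskian_constant[OF fund_ode_solution(1) assms, of x x0] by simp
  show "u x = u x0 * u1 \<omega> x + v x0 * u2 \<omega> x"
    unfolding 1[symmetric] 2[symmetric] using fund_det[of \<omega> x] by algebra
  show "v x = u x0 * v1 \<omega> x + v x0 * v2 \<omega> x"
    unfolding 1[symmetric] 2[symmetric] using fund_det[of \<omega> x] by algebra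
qed

abbreviation "T11 \<omega> \<equiv> u1 \<omega> (x0 + 1)"
abbreviation "T12 \<omega> \<equiv> u2 \<omega> (x0 + 1)"
abbreviation "T21 \<omega> \<equiv> v1 \<omega> (x0 + 1)"
abbreviation "T22 \<omega> \<equiv> v2 \<omega> (x0 + 1)"

text \<open>Reflecting a fundamental solution about \<open>x0\<close> expresses the inverse of the transfer matrix
  through the transfer matrix, and comparing it with the adjugate equates the diagonal entries.\<close>

lemma
  shows transfer_diagonal: "T22 \<omega> = T11 \<omega>"
    and transfer_det: "(T11 \<omega>)\<^sup>2 - T12 \<omega> * T21 \<omega> = 1"
proof -
  note refl1 = ode_solution_reflect[OF fund_ode_solution(1)[of \<omega>] eps_symmetric]
  note refl2 = ode_solution_reflect[OF fund_ode_solution(2)[of \<omega>] eps_symmetric]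
  note rep1 = ode_solution_representation[OF refl1] and rep2 = ode_solution_representation[OF refl2]
  have "u1 \<omega> (x0 - 1) = T11 \<omega>" "- v1 \<omega> (x0 - 1) = T21 \<omega>"
    "u2 \<omega> (x0 - 1) = - T12 \<omega>" "v2 \<omega> (x0 - 1) = T22 \<omega>"
    using rep1(1)[of "x0 + 1"] rep1(2)[of "x0 + 1"] rep2(1)[of "x0 + 1"] rep2(2)[of "x0 + 1"]
    by (simp_all add: algebra_simps)
  then have m1: "u1 \<omega> (x0 - 1) = T11 \<omega>" "v1 \<omega> (x0 - 1) = - T21 \<omega>"
    "u2 \<omega> (x0 - 1) = - T12 \<omega>" "v2 \<omega> (x0 - 1) = T22 \<omega>"
    by (simp_all add: minus_equation_iff[of "v1 \<omega> (x0 - 1)"])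
  have "eps (x + - 1) = eps x" for x
    using eps_periodic[of "x - 1"] by simp
  note tr1 = ode_solution_translate[OF fund_ode_solution(1)[of \<omega>] this]
   and tr2 = ode_solution_translate[OF fund_ode_solution(2)[of \<omega>] this]
  \<comment> \<open>The solutions translated by one period have at \<open>x0\<close> the data found
    at \<open>x0 - 1\<close>, and they return to the original data at \<open>x0 + 1\<close>; so 1
    and 2 are diagonal entries of the identity matrix.\<close>
  have 1: "T11 \<omega> * T11 \<omega> - T21 \<omega> * T12 \<omega> = 1"
    using ode_solution_representation(1)[OF tr1, of "x0 + 1"] m1 by simp
  have 2: "T22 \<omega> * T22 \<omega> - T12 \<omega> * T21 \<omega> = 1"
    using ode_solution_representation(2)[OF tr2, of "x0 + 1"] m1 by simp
  have 3: "T11 \<omega> * T22 \<omega> - T21 \<omega> * T12 \<omega> = 1"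
    using fund_det by simp
  \<comment> \<open>By 1, 2 and 3 the terms of the expanded square are 1 + bc, 1 + bc and - 2 (1 +
    bc), where bc is \<open>T12 \<omega> * T21 \<omega>\<close>.\<close>
  have "(T22 \<omega> - T11 \<omega>)\<^sup>2 = 0"
    using 1 2 3 by algebra
  then show "T22 \<omega> = T11 \<omega>"
    by simp
  show "(T11 \<omega>)\<^sup>2 - T12 \<omega> * T21 \<omega> = 1"
    using 1 by (simp add: power2_eq_square mult.commute)
qed

lemma floquet_multiplier:
  assumes sol: "ode_solution eps (m * \<omega>\<^sup>2) u v"
    and "u (x0 + 1) = \<rho> * u x0" "v (x0 + 1) = \<rho> * v x0"
  shows "u (x + 1) = \<rho> * u x" "v (x + 1) = \<rho> * v x"
  using ode_solution_representation[OF ode_solution_translate[OF sol eps_periodic], of x]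
    ode_solution_representation[OF sol, of x] assms(2,3)
  by (simp_all add: algebra_simps)

end

section \<open>Solutions in a permittivity and the Floquet-Bloch spectrum\<close>

lemma smooth_near_open: "open {x. smooth_near f x}"
proof (rule openI)
  fix x assume "x \<in> {x. smooth_near f x}"
  then obtain U where "open U" "x \<in> U"
    "\<forall>n. \<forall>y\<in>U. ((\<lambda>g t. vector_derivative g (at t)) ^^ n) f differentiable (at y)"
    by (auto simp: smooth_near_def)
  moreover from this obtain e where "0 < e" "ball x e \<subseteq> U"
    using open_contains_ball by blast
  ultimately show "\<exists>T>0. ball x T \<subseteq> {x. smooth_near f x}"
    unfolding smooth_near_def by blast
qed

lemma open_not_breakpoints: "open (- breakpoints f)"
  using smooth_near_open[of f] by (simp add: breakpoints_def Compl_eq)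

lemma isCont_not_breakpoint:
  assumes "x \<notin> breakpoints f"
  shows "isCont f x"
proof -
  have "smooth_near f x"
    using assms by (simp add: breakpoints_def)
  then have "((\<lambda>g t. vector_derivative g (at t)) ^^ 0) f differentiable (at x)"
    unfolding smooth_near_def by blast
  then show ?thesis
    using differentiable_imp_continuous_within by auto
qed

lemma periodic_has_vector_derivative_iff:
  fixes f :: "real \<Rightarrow> complex"
  assumes "\<And>x. f (x + p) = f x"
  shows "(f has_vector_derivative D) (at (x + p)) \<longleftrightarrow> (f has_vector_derivative D) (at x)"
proof -
  have shift: "((\<lambda>y. y + q) has_vector_derivative 1) (at x)" for q x :: real
    by (auto intro: derivative_eq_intros)
  have "(f has_vector_derivative D) (at x)" if "(f has_vector_derivative D) (at (x + p))" for x
    using vector_diff_chain_at[OF shift that] assms by (simp add: o_def)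
  moreover have "(f has_vector_derivative D) (at (x + p))" if D: "(f has_vector_derivative D) (at x)"
  proof -
    have "(f has_vector_derivative D) (at ((x + p) + - p))"
      using D by simp
    from vector_diff_chain_at[OF shift this] have "((\<lambda>y. f (y - p)) has_vector_derivative D) (at (x + p))"
      by (simp add: o_def)
    moreover have "f (y - p) = f y" for y
      using assms[of "y - p"] by simp
    ultimately show ?thesis
      by simp
  qed
  ultimately show ?thesis by blast
qed

text \<open>\<open>vector_derivative\<close> chooses from the same predicate at both points, so the
  identity also holds where no derivative exists. Hence all iterated derivatives in
  \<open>smooth_near\<close> inherit the period.\<close>

lemma periodic_vector_derivative:
  fixes f :: "real \<Rightarrow> complex"
  assumes "\<And>x. f (x + p) = f x"
  shows "vector_derivative f (at (x + p)) = vector_derivative f (at x)"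
  unfolding vector_derivative_def using periodic_has_vector_derivative_iff[of f p, OF assms] by simp

lemma smooth_near_periodic:
  assumes per: "\<And>x. f (x + p) = f x" and "smooth_near f (x + p)"
  shows "smooth_near f x"
proof -
  let ?D = "\<lambda>n. ((\<lambda>g t. vector_derivative g (at t)) ^^ n) f"
  have perD: "?D n (x + p) = ?D n x" for n x
  proof (induction n arbitrary: x)
    case 0
    then show ?case by (simp add: per)
  next
    case (Suc n)
    then show ?case
      using periodic_vector_derivative[of "?D n" p] by simp
  qed
  obtain U where U: "open U" "x + p \<in> U" "\<And>n y. y \<in> U \<Longrightarrow> ?D n differentiable (at y)"
    using assms(2) by (auto simp: smooth_near_def)
  have "open ((\<lambda>x. x + p) -` U)"
    by (intro open_vimage U(1) continuous_intros)
  moreover have "?D n differentiable (at y)" if "y \<in> (\<lambda>x. x + p) -` U" for n y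
  proof -
    have "(?D n has_vector_derivative vector_derivative (?D n) (at (y + p))) (at (y + p))"
      using U(3)[of "y + p" n] that by (simp add: vector_derivative_works)
    then have "(?D n has_vector_derivative vector_derivative (?D n) (at (y + p))) (at y)"
      using periodic_has_vector_derivative_iff[of "?D n", OF perD] by blast
    then show ?thesis
      by (rule differentiableI_vector)
  qed
  ultimately show ?thesis
    unfolding smooth_near_def using U(2) by (intro exI[of _ "(\<lambda>x. x + p) -` U"]) auto
qed

lemma periodic_of_int:
  fixes f :: "real \<Rightarrow> 'a"
  assumes "\<And>x. f (x + 1) = f x"
  shows "f (x + of_int n) = f x"
proof (induction n rule: int_induct[where k = 0])
  case (step1 i)
  then show ?case
    using assms[of "x + of_int i"] by (simp add: add.assoc)
next
  case (step2 i)
  then show ?case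
    using assms[of "x + of_int i - 1"] by (simp add: algebra_simps)
qed simp

lemma breakpoints_periodic:
  assumes "\<And>x. f (x + 1) = f x"
  shows "x + of_int n \<in> breakpoints f \<longleftrightarrow> x \<in> breakpoints f"
proof -
  have per: "f (x + of_int n) = f x" for x n
    using periodic_of_int[of f] assms by blast
  have "smooth_near f (x + of_int n) \<Longrightarrow> smooth_near f x" for x n
    by (rule smooth_near_periodic[where p = "of_int n"]) (rule per)
  from this[of x n] this[of "x + of_int n" "- n"] show ?thesis
    by (auto simp: breakpoints_def)
qed

lemma locally_finite_breakpoints:
  assumes "\<And>x. f (x + 1) = f x" "finite (breakpoints f \<inter> {0..<1})"
  shows "locally_finite_set (breakpoints f)"
  unfolding locally_finite_set_def
proof (intro allI)
  fix a b :: real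
  let ?S = "(\<lambda>(n, y). y + of_int n) ` ({\<lfloor>a\<rfloor>..\<lfloor>b\<rfloor>} \<times> (breakpoints f \<inter> {0..<1}))"
  have "breakpoints f \<inter> {a..b} \<subseteq> ?S"
  proof
    fix x assume x: "x \<in> breakpoints f \<inter> {a..b}"
    have "frac x + of_int \<lfloor>x\<rfloor> \<in> breakpoints f"
      using x by (simp add: frac_def)
    then have "frac x \<in> breakpoints f"
      using breakpoints_periodic[of f "frac x" "\<lfloor>x\<rfloor>"] assms(1) by blast
    moreover have "\<lfloor>x\<rfloor> \<in> {\<lfloor>a\<rfloor>..\<lfloor>b\<rfloor>}"
      using x by (auto intro: floor_mono)
    ultimately show "x \<in> ?S"
      using frac_ge_0[of x] frac_lt_1[of x]
      by (intro image_eqI[of _ _ "(\<lfloor>x\<rfloor>, frac x)"]) (auto simp: frac_def)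
  qed
  moreover have "finite ?S"
    using assms(2) by simp
  ultimately show "finite (breakpoints f \<inter> {a..b})"
    using finite_subset by blast
qed

section \<open>Boundedness and symmetry of a permittivity\<close>

lemma one_sided_limits_locally_bounded:
  assumes "has_one_sided_limits f"
  shows "\<exists>U K. open U \<and> x \<in> U \<and> (\<forall>y\<in>U. norm (f y) \<le> K)"
proof -
  obtain l r where "(f \<longlongrightarrow> l) (at_left x)" "(f \<longlongrightarrow> r) (at_right x)"
    using assms unfolding has_one_sided_limits_def by blast
  then have "eventually (\<lambda>y. dist (f y) l < 1) (at_left x)" "eventually (\<lambda>y. dist (f y) r < 1) (at_right x)"
    by (auto intro: tendstoD)
  then have "eventually (\<lambda>y. dist (f y) l < 1 \<or> dist (f y) r < 1) (at x)"
    unfolding eventually_at_split by (auto elim: eventually_mono)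
  then obtain U where "open U" "x \<in> U" and U: "\<And>y. y \<in> U \<Longrightarrow> y \<noteq> x \<Longrightarrow> dist (f y) l < 1 \<or> dist (f y) r < 1"
    unfolding eventually_at_topological by blast
  moreover have "norm (f y) \<le> norm (f x) + norm l + norm r + 1" if "y \<in> U" for y
  proof (cases "y = x")
    case False
    then have "norm (f y) \<le> norm l + 1 \<or> norm (f y) \<le> norm r + 1"
      using U[OF that] norm_triangle_ineq2[of "f y" l] norm_triangle_ineq2[of "f y" r]
      unfolding dist_norm by linarith
    then show ?thesis
      using norm_ge_zero[of "f x"] norm_ge_zero[of l] norm_ge_zero[of r] by linarith
  qed (simp add: add_nonneg_nonneg)
  ultimately show ?thesis by blast
qed

lemma permittivity_bounded:
  assumes "permittivity x0 eps"
  obtains M where "\<And>x. norm (eps x) \<le> M"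
proof -
  have "\<forall>x. \<exists>U K. open U \<and> x \<in> U \<and> (\<forall>y\<in>U. norm (eps y) \<le> K)"
    using assms one_sided_limits_locally_bounded by (auto simp: permittivity_def)
  then obtain U K where U: "\<And>x. open (U x)" "\<And>x. x \<in> U x" and K: "\<And>x y. y \<in> U x \<Longrightarrow> norm (eps y) \<le> K x"
    by metis
  have "compact {0..1::real}" by simp
  then obtain C where C: "finite C" "{0..1} \<subseteq> (\<Union>x\<in>C. U x)"
    by (rule compactE_image[of "{0..1}" UNIV U]) (use U in blast)+
  have "norm (eps x) \<le> (\<Sum>x\<in>C. \<bar>K x\<bar>)" for x
  proof -
    have "eps x = eps (frac x)"
      using periodic_of_int[of eps "frac x" "\<lfloor>x\<rfloor>"] assms by (simp add: permittivity_def frac_def)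
    moreover have "frac x \<in> {0..1}"
      using frac_lt_1[of x] by (simp add: less_imp_le)
    then obtain y where y: "y \<in> C" "frac x \<in> U y"
      using C(2) by blast
    then have "norm (eps (frac x)) \<le> \<bar>K y\<bar>"
      using K[of "frac x" y] by linarith
    moreover have "\<bar>K y\<bar> \<le> (\<Sum>x\<in>C. \<bar>K x\<bar>)"
      using C(1) y(1) by (intro member_le_sum) auto
    ultimately show ?thesis by simp
  qed
  then show ?thesis using that by blast
qed

text \<open>With h the fractional part of \<open>x - x0\<close>, the points \<open>x\<close> and
  \<open>2 * x0 - x\<close> are integer translates of x0 + h and x0 - h. For h = 0 these coincide;
  otherwise the inversion symmetry applies up to one period.\<close>

lemma permittivity_symmetric:
  assumes "permittivity x0 eps"
  shows "eps (2 * x0 - x) = eps x"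
proof -
  have per: "eps (x + of_int n) = eps x" for x n
    using assms periodic_of_int[of eps x n] by (simp add: permittivity_def)
  let ?h = "frac (x - x0)" and ?n = "\<lfloor>x - x0\<rfloor>"
  have x: "x = (x0 + ?h) + of_int ?n"
    by (simp add: frac_def)
  have "eps x = eps (x0 + ?h)"
    by (subst x) (rule per)
  also have "eps (x0 + ?h) = eps (x0 - ?h)"
  proof (cases "?h = 0")
    case False
    then have "?h \<in> {0<..<1}"
      using frac_lt_1[of "x - x0"] frac_ge_0[of "x - x0"] by (simp add: less_le)
    then have "eps (x0 + ?h) = eps (x0 + 1 - ?h)"
      using assms by (auto simp: permittivity_def)
    also have "x0 + 1 - ?h = (x0 - ?h) + of_int 1"
      by simp
    finally show ?thesis
      by (simp only: per)
  qed (simp del: frac_eq_0_iff)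
  also have "eps (x0 - ?h) = eps ((x0 - ?h) + of_int (- ?n))"
    by (rule per[symmetric])
  also have "(x0 - ?h) + of_int (- ?n) = 2 * x0 - x"
    by (simp add: frac_def)
  finally show ?thesis by simp
qed

section \<open>Passage between solutions of the equation and the first-order system\<close>

locale permittivity_medium =
  fixes x0 mu0 :: real and eps :: "real \<Rightarrow> complex" and M :: real
  assumes mu0_pos: "0 < mu0" and mu0_le: "mu0 \<le> M"
    and eps_le: "norm (eps x) \<le> M"
    and permittivity: "permittivity x0 eps"
begin

lemma period: "eps (x + 1) = eps x"
  using permittivity by (simp add: permittivity_def)

lemma breakpoints_locally_finite: "locally_finite_set (breakpoints eps)"
  using permittivity period by (intro locally_finite_breakpoints) (auto simp: permittivity_def)

lemma eps_nonzero: "eps x \<noteq> 0"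
  using permittivity by (auto simp: permittivity_def dest!: spec[of _ x])

end

sublocale permittivity_medium \<subseteq> medium x0 "- complex_of_real mu0" eps M
proof
  show "weight M eps"
    unfolding weight_def using eps_le breakpoints_locally_finite isCont_not_breakpoint by blast
  show "norm (- complex_of_real mu0) \<le> M"
    using mu0_pos mu0_le by simp
qed (use period permittivity_symmetric[OF permittivity] in auto)

context permittivity_medium
begin

abbreviation comb_u :: "complex \<Rightarrow> complex \<Rightarrow> complex \<Rightarrow> real \<Rightarrow> complex" where
  "comb_u p q \<omega> x \<equiv> p * u1 \<omega> x + q * u2 \<omega> x"

abbreviation comb_v :: "complex \<Rightarrow> complex \<Rightarrow> complex \<Rightarrow> real \<Rightarrow> complex" where
  "comb_v p q \<omega> x \<equiv> p * v1 \<omega> x + q * v2 \<omega> x"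

lemma comb_ode_solution: "ode_solution eps (- complex_of_real mu0 * \<omega>\<^sup>2) (comb_u p q \<omega>) (comb_v p q \<omega>)"
  by (rule ode_solution_combination[OF fund_ode_solution])

lemma comb_u_derivative:
  assumes "x \<notin> breakpoints eps"
  shows "(comb_u p q \<omega> has_vector_derivative eps x * comb_v p q \<omega> x) (at x)"
proof -
  have "(comb_u p q \<omega> has_vector_derivative p * (eps x * v1 \<omega> x) + q * (eps x * v2 \<omega> x)) (at x)"
    using fund_u_derivative[OF isCont_not_breakpoint[OF assms]]
    by (intro has_vector_derivative_add has_vector_derivative_mult_right)
  then show ?thesis
    by (simp add: algebra_simps)
qed

lemma comb_v_derivative:
  "(comb_v p q \<omega> has_vector_derivative - complex_of_real mu0 * \<omega>\<^sup>2 * comb_u p q \<omega> x) (at x)"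
proof -
  have "(comb_v p q \<omega> has_vector_derivative
      p * (- complex_of_real mu0 * \<omega>\<^sup>2 * u1 \<omega> x) + q * (- complex_of_real mu0 * \<omega>\<^sup>2 * u2 \<omega> x)) (at x)"
    by (intro has_vector_derivative_add has_vector_derivative_mult_right fund_v_derivative)
  then show ?thesis
    by (simp add: algebra_simps)
qed

lemma comb_flux:
  assumes "x \<notin> breakpoints eps"
  shows "flux eps (comb_u p q \<omega>) x = comb_v p q \<omega> x"
  using vector_derivative_at[OF comb_u_derivative[OF assms]] eps_nonzero[of x]
  by (simp add: flux_def)

lemma comb_solution: "solution mu0 eps \<omega> (comb_u p q \<omega>)"
  unfolding solution_def
proof (intro conjI allI impI)
  show "continuous_on UNIV (comb_u p q \<omega>)"
    by (intro continuous_intros fund_continuous)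
  show "\<exists>v. continuous_on UNIV v \<and> (\<forall>x. x \<notin> breakpoints eps \<longrightarrow> v x = flux eps (comb_u p q \<omega>) x)"
    by (rule exI[of _ "comb_v p q \<omega>"]) (auto simp: comb_flux intro!: continuous_intros fund_continuous)
  fix x assume x: "x \<notin> breakpoints eps"
  show "comb_u p q \<omega> differentiable (at x)"
    using comb_u_derivative[OF x] by (rule differentiableI_vector)
  have D: "(flux eps (comb_u p q \<omega>) has_vector_derivative
      - complex_of_real mu0 * \<omega>\<^sup>2 * comb_u p q \<omega> x) (at x)"
    by (rule has_vector_derivative_transform_within_open[OF comb_v_derivative open_not_breakpoints])
      (use x in \<open>auto simp: comb_flux\<close>)
  then show "flux eps (comb_u p q \<omega>) differentiable (at x)"
    by (rule differentiableI_vector)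
  show "L_op mu0 eps (comb_u p q \<omega>) x = \<omega>\<^sup>2 * comb_u p q \<omega> x"
    unfolding L_op_def vector_derivative_at[OF D] using mu0_pos by simp
qed

text \<open>The continuous extension \<open>v\<close> of the flux is the second component. It agrees
  with the flux on the open complement of the breakpoints, so derivatives of the flux there are
  derivatives of \<open>v\<close>, and the representation by the data at \<open>x0\<close>
  applies.\<close>

lemma solution_imp_comb:
  assumes "solution mu0 eps \<omega> u"
  obtains p q where "u = comb_u p q \<omega>"
proof -
  obtain v where v: "continuous_on UNIV v" "\<And>x. x \<notin> breakpoints eps \<Longrightarrow> v x = flux eps u x"
    using assms by (auto simp: solution_def)
  have "(u has_vector_derivative eps x * v x) (at x) \<and>
      (v has_vector_derivative - complex_of_real mu0 * \<omega>\<^sup>2 * u x) (at x)" if x: "x \<notin> breakpoints eps" for x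
  proof
    have "(u has_vector_derivative vector_derivative u (at x)) (at x)"
      using assms x by (auto simp: solution_def vector_derivative_works)
    then show "(u has_vector_derivative eps x * v x) (at x)"
      using eps_nonzero[of x] by (simp add: v(2)[OF x] flux_def)
    have "(flux eps u has_vector_derivative vector_derivative (flux eps u) (at x)) (at x)"
      using assms x by (auto simp: solution_def vector_derivative_works)
    then have "(v has_vector_derivative vector_derivative (flux eps u) (at x)) (at x)"
      by (rule has_vector_derivative_transform_within_open[OF _ open_not_breakpoints])
        (use x v(2) in auto)
    moreover have "- (1 / complex_of_real mu0) * vector_derivative (flux eps u) (at x) = \<omega>\<^sup>2 * u x"
      using assms x by (auto simp: solution_def L_op_def)
    then have "vector_derivative (flux eps u) (at x) = - complex_of_real mu0 * \<omega>\<^sup>2 * u x"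
      using mu0_pos
      by (simp add: field_simps minus_equation_iff[of "vector_derivative (flux eps u) (at x)"])
    ultimately show "(v has_vector_derivative - complex_of_real mu0 * \<omega>\<^sup>2 * u x) (at x)"
      by simp
  qed
  then have "ode_solution eps (- complex_of_real mu0 * \<omega>\<^sup>2) u v"
    using assms v(1) breakpoints_locally_finite by (auto simp: ode_solution_def solution_def)
  from ode_solution_representation(1)[OF this] show ?thesis
    by (intro that[of "u x0" "v x0"] ext)
qed

text \<open>If \<open>u\<close> vanishes, so does its flux off the breakpoints, because
  \<open>eps\<close> has no zeros, and there the determinant 1 excludes a nontrivial combination. A
  Floquet condition on \<open>u\<close> alone thus controls the flux as well.\<close>

lemma comb_u_zero:
  assumes "\<And>x. comb_u p q \<omega> x = 0"
  shows "p = 0 \<and> q = 0"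
proof -
  have p: "p = 0"
    using assms[of x0] by simp
  obtain x where x: "x \<notin> breakpoints eps"
    using eventually_happens[OF locally_finite_set_eventually[OF breakpoints_locally_finite, of 0]] by auto
  have "comb_u p q \<omega> = (\<lambda>x. 0)"
    using assms by auto
  then have "((\<lambda>x. 0) has_vector_derivative eps x * comb_v p q \<omega> x) (at x)"
    using comb_u_derivative[OF x, of p \<omega> q] by simp
  then have "eps x * comb_v p q \<omega> x = 0"
    using vector_derivative_at has_vector_derivative_const by metis
  then have "q * v2 \<omega> x = 0"
    using p eps_nonzero by simp
  moreover have "q * u2 \<omega> x = 0"
    using assms[of x] p by simp
  ultimately have "q = 0"
    using fund_det[of \<omega> x] by algebra
  with p show ?thesis by simp
qed

text \<open>The right-hand side is the eigenvalue equation of the transfer matrix for the data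
  \<open>(p, q)\<close>, with \<open>T22\<close> already replaced by \<open>T11\<close>. From left
  to right, the translated solution minus \<rho> times the original one is a combination that
  vanishes identically.\<close>

lemma comb_floquet_iff:
  "(\<forall>x. comb_u p q \<omega> (x + 1) = \<rho> * comb_u p q \<omega> x) \<longleftrightarrow>
     T11 \<omega> * p + T12 \<omega> * q = \<rho> * p \<and> T21 \<omega> * p + T11 \<omega> * q = \<rho> * q" (is "?L \<longleftrightarrow> ?R")
proof
  assume L: ?L
  let ?p = "comb_u p q \<omega> (x0 + 1)" and ?q = "comb_v p q \<omega> (x0 + 1)"
  have "comb_u (?p - \<rho> * p) (?q - \<rho> * q) \<omega> x = 0" for x
    using ode_solution_representation(1)[OF ode_solution_translate[OF comb_ode_solution[of \<omega> p q] eps_periodic], of x] spec[OF L, of x]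
    by (simp add: algebra_simps)
  from comb_u_zero[OF this] show ?R
    using transfer_diagonal[of \<omega>] by (simp add: algebra_simps)
next
  assume R: ?R
  have "comb_u p q \<omega> (x0 + 1) = \<rho> * comb_u p q \<omega> x0" "comb_v p q \<omega> (x0 + 1) = \<rho> * comb_v p q \<omega> x0"
    using R by (simp_all add: transfer_diagonal mult.commute)
  from floquet_multiplier(1)[OF comb_ode_solution this] show ?L
    by blast
qed

lemma comb_v_floquet:
  assumes "T11 \<omega> * p + T12 \<omega> * q = \<rho> * p" "T21 \<omega> * p + T11 \<omega> * q = \<rho> * q"
  shows "comb_v p q \<omega> (x + 1) = \<rho> * comb_v p q \<omega> x"
proof -
  have "comb_u p q \<omega> (x0 + 1) = \<rho> * comb_u p q \<omega> x0" "comb_v p q \<omega> (x0 + 1) = \<rho> * comb_v p q \<omega> x0"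
    using assms by (simp_all add: transfer_diagonal mult.commute)
  from floquet_multiplier(2)[OF comb_ode_solution this] show ?thesis .
qed

lemma floquet_bloch_spectrum_iff:
  "\<omega> \<in> floquet_bloch_spectrum mu0 eps \<longleftrightarrow> T11 \<omega> \<in> complex_of_real ` {-1..1}"
proof
  assume "\<omega> \<in> floquet_bloch_spectrum mu0 eps"
  then obtain \<kappa> u where u: "solution mu0 eps \<omega> u" "\<exists>x. u x \<noteq> 0"
    "\<And>x. u (x + 1) = exp (\<i> * complex_of_real \<kappa>) * u x"
    unfolding floquet_bloch_spectrum_def by blast
  define \<rho> where "\<rho> = exp (\<i> * complex_of_real \<kappa>)"
  obtain p q where pq: "u = comb_u p q \<omega>"
    using solution_imp_comb[OF u(1)] .
  then have nz: "p \<noteq> 0 \<or> q \<noteq> 0"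
    using u(2) by auto
  have "T11 \<omega> * p + T12 \<omega> * q = \<rho> * p \<and> T21 \<omega> * p + T11 \<omega> * q = \<rho> * q"
    using u(3) comb_floquet_iff[of p \<omega> q \<rho>] unfolding pq \<rho>_def by blast
  then have "p * (\<rho>\<^sup>2 - 2 * T11 \<omega> * \<rho> + 1) = 0" "q * (\<rho>\<^sup>2 - 2 * T11 \<omega> * \<rho> + 1) = 0"
    using transfer_det[of \<omega>] by algebra+
  then have eq: "\<rho>\<^sup>2 - 2 * T11 \<omega> * \<rho> + 1 = 0"
    using nz by auto
  have inv: "\<rho> * exp (- (\<i> * complex_of_real \<kappa>)) = 1"
    by (simp add: \<rho>_def exp_minus_inverse)
  then have "2 * T11 \<omega> = \<rho> + exp (- (\<i> * complex_of_real \<kappa>))"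
    using eq by algebra
  then have "T11 \<omega> = cos (complex_of_real \<kappa>)"
    by (simp add: cos_exp_eq \<rho>_def field_simps)
  then have "T11 \<omega> = complex_of_real (cos \<kappa>)"
    by (simp add: cos_of_real)
  then show "T11 \<omega> \<in> complex_of_real ` {-1..1}"
    by auto
next
  assume "T11 \<omega> \<in> complex_of_real ` {-1..1}"
  then obtain t where t: "-1 \<le> t" "t \<le> 1" and a: "T11 \<omega> = complex_of_real t"
    by auto
  define \<rho> where "\<rho> = exp (\<i> * complex_of_real (arccos t))"
  have inv: "\<rho> * exp (- (\<i> * complex_of_real (arccos t))) = 1"
    by (simp add: \<rho>_def exp_minus_inverse)
  have "T11 \<omega> = cos (complex_of_real (arccos t))"
    using t a by (simp add: cos_of_real cos_arccos)
  then have "2 * T11 \<omega> = \<rho> + exp (- (\<i> * complex_of_real (arccos t)))"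
    by (simp add: cos_exp_eq \<rho>_def field_simps)
  then have eq: "\<rho>\<^sup>2 - 2 * T11 \<omega> * \<rho> + 1 = 0"
    using inv by algebra
  \<comment> \<open>If \<open>T12 \<omega>\<close> is nonzero, the first equation determines the
    eigenvector up to scaling; otherwise the matrix is lower triangular with double eigenvalue
    \<rho>, and (0, 1) is an eigenvector.\<close>
  obtain p q where nz: "p \<noteq> 0 \<or> q \<noteq> 0"
    and pq: "T11 \<omega> * p + T12 \<omega> * q = \<rho> * p" "T21 \<omega> * p + T11 \<omega> * q = \<rho> * q"
  proof (cases "T12 \<omega> = 0")
    case True
    then have "(T11 \<omega> - \<rho>)\<^sup>2 = 0"
      using eq transfer_det[of \<omega>] by algebra
    then show ?thesis
      using True that[of 0 1] by simp
  next
    case False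
    have "T21 \<omega> * T12 \<omega> + T11 \<omega> * (\<rho> - T11 \<omega>) = \<rho> * (\<rho> - T11 \<omega>)"
      using eq transfer_det[of \<omega>] by algebra
    then show ?thesis
      using False that[of "T12 \<omega>" "\<rho> - T11 \<omega>"] by (simp add: algebra_simps)
  qed
  have per: "comb_u p q \<omega> (x + 1) = \<rho> * comb_u p q \<omega> x" for x
    using comb_floquet_iff pq by blast
  have "vector_derivative (comb_u p q \<omega>) (at (x + 1)) = \<rho> * vector_derivative (comb_u p q \<omega>) (at x)"
    if x: "x \<notin> breakpoints eps" for x
  proof -
    have "x + 1 \<notin> breakpoints eps"
      using breakpoints_periodic[of eps x 1, OF period] x by simp
    then show ?thesis
      using vector_derivative_at[OF comb_u_derivative[of "x + 1" p \<omega> q]] vector_derivative_at[OF comb_u_derivative[OF x, of p \<omega> q]]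
        comb_v_floquet[OF pq, of x] period[of x] by simp
  qed
  moreover have "\<exists>x. comb_u p q \<omega> x \<noteq> 0"
    using comb_u_zero[of p \<omega> q] nz by blast
  moreover have "arccos t \<in> {-pi..pi}"
    using arccos_lbound[OF t] arccos_ubound[OF t] pi_ge_zero by (auto intro: order_trans[of _ 0])
  ultimately show "\<omega> \<in> floquet_bloch_spectrum mu0 eps"
    unfolding floquet_bloch_spectrum_def using comb_solution per \<rho>_def by blast
qed

end

section \<open>Decaying solutions and surface impedances\<close>

text \<open>A branch of the square root of a^2 - 1 that is holomorphic off [-1, 1]: the argument of
  \<open>csqrt\<close> meets the branch cut only for a in that segment. For large a the root behaves
  like - a + 1 / (2a), so the sign makes \<open>a + decay_root a\<close> small.\<close>

definition decay_root :: "complex \<Rightarrow> complex" where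
  "decay_root a = - a * csqrt (1 - 1 / a\<^sup>2)"

lemma one_minus_inverse_square_notin_nonpos_Reals:
  assumes "a \<notin> complex_of_real ` {-1..1}"
  shows "1 - 1 / a\<^sup>2 \<notin> \<real>\<^sub>\<le>\<^sub>0"
proof
  assume "1 - 1 / a\<^sup>2 \<in> \<real>\<^sub>\<le>\<^sub>0"
  then obtain r where r: "1 - 1 / a\<^sup>2 = complex_of_real r" "r \<le> 0"
    by (auto elim!: nonpos_Reals_cases)
  \<comment> \<open>Solving 1 - 1 / a^2 = r gives a^2 = 1 / (1 - r), which lies in (0, 1] for r
    \<le> 0; so a is plus or minus this t.\<close>
  define t where "t = sqrt (1 / (1 - r))"
  have "a \<noteq> 0"
    using assms by (auto simp: image_iff dest: bspec[of _ _ 0])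
  then have "a\<^sup>2 * (1 - complex_of_real r) = 1"
    using r(1) by (simp add: field_simps)
  moreover have t2: "(complex_of_real t)\<^sup>2 * (1 - complex_of_real r) = 1"
  proof -
    have "t\<^sup>2 * (1 - r) = 1"
      using r(2) by (simp add: t_def)
    then show ?thesis
      by (metis of_real_1 of_real_diff of_real_mult of_real_power)
  qed
  ultimately have "(a - complex_of_real t) * (a + complex_of_real t) = 0"
    by algebra
  then have "a = complex_of_real t \<or> a = complex_of_real (- t)"
    by (auto simp: add_eq_0_iff)
  moreover have "0 \<le> t" "t \<le> 1"
    using r(2) by (auto simp: t_def real_sqrt_le_1_iff)
  ultimately show False
    using assms by auto
qed

lemma decay_root_square:
  assumes "a \<notin> complex_of_real ` {-1..1}"
  shows "(decay_root a)\<^sup>2 = a\<^sup>2 - 1"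
proof -
  have "a \<noteq> 0"
    using assms by (auto simp: image_iff dest: bspec[of _ _ 0])
  then show ?thesis
    by (simp add: decay_root_def power_mult_distrib field_simps)
qed

lemma decay_root_nonzero:
  assumes "a \<notin> complex_of_real ` {-1..1}"
  shows "decay_root a \<noteq> 0"
proof
  assume "decay_root a = 0"
  then have "(a - 1) * (a + 1) = 0"
    using decay_root_square[OF assms] by algebra
  then have "a = complex_of_real 1 \<or> a = complex_of_real (- 1)"
    by (auto simp: eq_neg_iff_add_eq_0)
  moreover have "complex_of_real 1 \<in> complex_of_real ` {-1..1}" "complex_of_real (- 1) \<in> complex_of_real ` {-1..1}"
    by (intro imageI; simp)+
  ultimately show False
    using assms by blast
qed

text \<open>\<open>a + decay_root a\<close> and \<open>a - decay_root a\<close> are mutually inverse, and the branch of the root is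
  chosen such that the former is the smaller one.\<close>

lemma norm_decay_root:
  assumes "a \<notin> complex_of_real ` {-1..1}"
  shows "norm (a + decay_root a) < 1"
proof -
  define w where "w = csqrt (1 - 1 / a\<^sup>2)"
  \<comment> \<open>A principal root has nonnegative real part; a vanishing one would put 1 - 1 /
    a^2 on the branch cut.\<close>
  have "0 < Re w"
  proof (rule ccontr)
    assume "\<not> 0 < Re w"
    then have "Re w = 0"
      using csqrt_principal[of "1 - 1 / a\<^sup>2"] by (simp add: w_def)
    then have "w\<^sup>2 = complex_of_real (- (Im w)\<^sup>2)"
      by (simp add: complex_eq_iff power2_eq_square)
    moreover have "w\<^sup>2 = 1 - 1 / a\<^sup>2"
      by (simp add: w_def)
    ultimately have "1 - 1 / a\<^sup>2 \<in> \<real>\<^sub>\<le>\<^sub>0"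
      by (metis neg_le_0_iff_le nonpos_Reals_of_real_iff zero_le_power2)
    then show False
      using one_minus_inverse_square_notin_nonpos_Reals[OF assms] by simp
  qed
  \<comment> \<open>The difference of the two squares is \<open>4 * Re w\<close>.\<close>
  then have "(norm (1 - w))\<^sup>2 < (norm (1 + w))\<^sup>2"
    unfolding cmod_power2 by (simp add: power2_eq_square algebra_simps)
  then have less: "norm (1 - w) < norm (1 + w)"
    by (rule power_less_imp_less_base) simp
  have "a \<noteq> 0"
    using assms by (auto simp: image_iff dest: bspec[of _ _ 0])
  have "(a + decay_root a) * (a - decay_root a) = 1"
    using decay_root_square[OF assms] by algebra
  then have 1: "norm (a + decay_root a) * norm (a - decay_root a) = 1"
    by (metis norm_mult norm_one)
  have "a + decay_root a = a * (1 - w)" "a - decay_root a = a * (1 + w)"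
    by (simp_all add: decay_root_def w_def algebra_simps)
  then have "norm (a + decay_root a) < norm (a - decay_root a)"
    using less \<open>a \<noteq> 0\<close> by (simp add: norm_mult)
  moreover have "norm (a - decay_root a) \<le> 1" if "1 \<le> norm (a + decay_root a)"
    using mult_right_mono[OF that norm_ge_zero[of "a - decay_root a"]] 1 by simp
  ultimately show ?thesis
    by linarith
qed

lemma holomorphic_decay_root: "decay_root holomorphic_on (- (complex_of_real ` {-1..1}))"
proof -
  have "a \<noteq> 0" if "a \<in> - (complex_of_real ` {-1..1})" for a
    using that by (auto simp: image_iff dest: bspec[of _ _ 0])
  then show ?thesis
    unfolding decay_root_def
    using one_minus_inverse_square_notin_nonpos_Reals
    by (intro holomorphic_intros) auto
qed

section \<open>Decay of functions with a Floquet multiplier\<close>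

lemma tendsto_at_top_of_multiplier:
  fixes f :: "real \<Rightarrow> complex"
  assumes cont: "continuous_on UNIV f" and mult: "\<And>x. f (x + 1) = \<rho> * f x" and \<rho>: "norm \<rho> < 1"
  shows "(f \<longlongrightarrow> 0) at_top"
proof -
  have "compact (f ` {0..1})"
    using cont by (intro compact_continuous_image) (auto intro: continuous_on_subset)
  then obtain C where C: "\<And>x. x \<in> {0..1} \<Longrightarrow> norm (f x) \<le> C"
    by (meson bounded_iff compact_imp_bounded imageI)
  have shift: "f (x + real n) = \<rho> ^ n * f x" for x n
    by (induction n) (simp_all add: mult[symmetric] algebra_simps, metis add.assoc add.commute mult mult.assoc)
  have bound: "norm (f x) \<le> C * norm \<rho> ^ n" if "real n \<le> x" for x n
  proof -
    define k where "k = nat \<lfloor>x\<rfloor>"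
    have k: "n \<le> k" "x = frac x + real k"
      using that by (auto simp: k_def frac_def le_nat_floor of_nat_nat)
    have "norm (f x) = norm \<rho> ^ k * norm (f (frac x))"
      by (subst k(2), subst shift) (simp add: norm_mult norm_power)
    also have "\<dots> \<le> norm \<rho> ^ k * C"
      using frac_lt_1[of x] by (intro mult_left_mono C) (auto simp: less_imp_le)
    also have "\<dots> \<le> norm \<rho> ^ n * C"
      using \<rho> k(1) order_trans[OF norm_ge_zero C[of 0]]
      by (intro mult_right_mono power_decreasing) auto
    finally show ?thesis
      by (simp add: mult.commute)
  qed
  show ?thesis
  proof (rule tendstoI)
    fix e :: real assume "0 < e"
    have "(\<lambda>n. C * norm \<rho> ^ n) \<longlonglongrightarrow> C * 0"
      using \<rho> by (intro tendsto_mult tendsto_const LIMSEQ_power_zero) auto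
    then have "eventually (\<lambda>n. C * norm \<rho> ^ n < e) sequentially"
      using \<open>0 < e\<close> by (auto intro: order_tendstoD)
    then obtain n where "C * norm \<rho> ^ n < e"
      by (auto simp: eventually_sequentially)
    then show "eventually (\<lambda>x. dist (f x) 0 < e) at_top"
      using bound[of n] unfolding eventually_at_top_linorder
      by (intro exI[of _ "real n"]) (auto simp: dist_norm intro: le_less_trans)
  qed
qed

lemma tendsto_at_bot_of_multiplier:
  fixes f :: "real \<Rightarrow> complex"
  assumes cont: "continuous_on UNIV f" and mult: "\<And>x. f x = \<rho> * f (x + 1)" and \<rho>: "norm \<rho> < 1"
  shows "(f \<longlongrightarrow> 0) at_bot"
proof -
  have "((\<lambda>x. f (- x)) \<longlongrightarrow> 0) at_top"
  proof (rule tendsto_at_top_of_multiplier[OF _ _ \<rho>])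
    show "continuous_on UNIV (\<lambda>x. f (- x))"
      by (rule continuous_on_compose2[OF cont]) (auto intro!: continuous_intros)
    show "f (- (x + 1)) = \<rho> * f (- x)" for x
      using mult[of "- x - 1"] by simp
  qed
  then show ?thesis
    by (simp add: filterlim_at_bot_mirror)
qed

context permittivity_medium
begin

lemma comb_decays_along:
  assumes "((comb_u p q \<omega>) \<longlongrightarrow> 0) F" "((comb_v p q \<omega>) \<longlongrightarrow> 0) F"
  shows "decays_along F eps (comb_u p q \<omega>)"
  unfolding decays_along_def
proof
  have "((\<lambda>x. M * norm (comb_v p q \<omega> x)) \<longlongrightarrow> M * 0) (inf F (principal (- breakpoints eps)))"
    using assms(2) by (intro tendsto_mult tendsto_const tendsto_norm_zero tendsto_mono[OF inf_le1])
  then have lim: "((\<lambda>x. M * norm (comb_v p q \<omega> x)) \<longlongrightarrow> 0) (inf F (principal (- breakpoints eps)))"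
    by simp
  show "((\<lambda>x. vector_derivative (comb_u p q \<omega>) (at x)) \<longlongrightarrow> 0) (inf F (principal (- breakpoints eps)))"
  proof (rule Lim_null_comparison[OF _ lim])
    have "norm (vector_derivative (comb_u p q \<omega>) (at x)) \<le> M * norm (comb_v p q \<omega> x)"
      if "x \<notin> breakpoints eps" for x
      unfolding vector_derivative_at[OF comb_u_derivative[OF that]] norm_mult
      using eps_le by (intro mult_right_mono) auto
    then show "\<forall>\<^sub>F x in inf F (principal (- breakpoints eps)).
        norm (vector_derivative (comb_u p q \<omega>) (at x)) \<le> M * norm (comb_v p q \<omega> x)"
      by (simp add: eventually_inf_principal)
  qed
qed (rule assms(1))

abbreviation gap_root :: "complex \<Rightarrow> complex" where
  "gap_root \<omega> \<equiv> decay_root (T11 \<omega>)"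

lemma gap_root_props:
  assumes "T11 \<omega> \<notin> complex_of_real ` {-1..1}"
  shows "(gap_root \<omega>)\<^sup>2 = T12 \<omega> * T21 \<omega>" "gap_root \<omega> \<noteq> 0" "T12 \<omega> \<noteq> 0"
    "norm (T11 \<omega> + gap_root \<omega>) < 1"
    "(T11 \<omega> + gap_root \<omega>) * (T11 \<omega> - gap_root \<omega>) = 1"
proof -
  show sq: "(gap_root \<omega>)\<^sup>2 = T12 \<omega> * T21 \<omega>"
    using decay_root_square[OF assms] transfer_det[of \<omega>] by algebra
  show nz: "gap_root \<omega> \<noteq> 0"
    by (rule decay_root_nonzero[OF assms])
  show "T12 \<omega> \<noteq> 0"
    using sq nz by auto
  show "norm (T11 \<omega> + gap_root \<omega>) < 1"
    by (rule norm_decay_root[OF assms])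
  show "(T11 \<omega> + gap_root \<omega>) * (T11 \<omega> - gap_root \<omega>) = 1"
    using sq transfer_det[of \<omega>] by algebra
qed

text \<open>For either sign of s the vector (b, s) is an eigenvector with eigenvalue a + s: the
  second component of its image is c b + a s = s^2 + a s.\<close>

lemma eigenvector_floquet:
  assumes "s\<^sup>2 = T12 \<omega> * T21 \<omega>"
  shows "comb_u (T12 \<omega>) s \<omega> (x + 1) = (T11 \<omega> + s) * comb_u (T12 \<omega>) s \<omega> x"
    "comb_v (T12 \<omega>) s \<omega> (x + 1) = (T11 \<omega> + s) * comb_v (T12 \<omega>) s \<omega> x"
proof -
  have 1: "T11 \<omega> * T12 \<omega> + T12 \<omega> * s = (T11 \<omega> + s) * T12 \<omega>"
    by (simp add: algebra_simps)
  have 2: "T21 \<omega> * T12 \<omega> + T11 \<omega> * s = (T11 \<omega> + s) * s"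
    using assms by algebra
  show "comb_u (T12 \<omega>) s \<omega> (x + 1) = (T11 \<omega> + s) * comb_u (T12 \<omega>) s \<omega> x"
    using comb_floquet_iff[of "T12 \<omega>" \<omega> s "T11 \<omega> + s"] 1 2 by blast
  show "comb_v (T12 \<omega>) s \<omega> (x + 1) = (T11 \<omega> + s) * comb_v (T12 \<omega>) s \<omega> x"
    by (rule comb_v_floquet[OF 1 2])
qed

lemma comb_continuous: "continuous_on UNIV (comb_u p q \<omega>)" "continuous_on UNIV (comb_v p q \<omega>)"
  by (intro continuous_intros fund_continuous)+

lemma decaying_at_top:
  assumes "T11 \<omega> \<notin> complex_of_real ` {-1..1}"
  shows "decays_along at_top eps (comb_u (T12 \<omega>) (gap_root \<omega>) \<omega>)"
proof -
  note step = eigenvector_floquet[OF gap_root_props(1)[OF assms]]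
  have "(comb_u (T12 \<omega>) (gap_root \<omega>) \<omega> \<longlongrightarrow> 0) at_top"
    by (rule tendsto_at_top_of_multiplier[OF comb_continuous(1) _ gap_root_props(4)[OF assms]]) (rule step)
  moreover have "(comb_v (T12 \<omega>) (gap_root \<omega>) \<omega> \<longlongrightarrow> 0) at_top"
    by (rule tendsto_at_top_of_multiplier[OF comb_continuous(2) _ gap_root_props(4)[OF assms]]) (rule step)
  ultimately show ?thesis
    by (rule comb_decays_along)
qed

lemma decaying_at_bot:
  assumes "T11 \<omega> \<notin> complex_of_real ` {-1..1}"
  shows "decays_along at_bot eps (comb_u (T12 \<omega>) (- gap_root \<omega>) \<omega>)"
proof -
  let ?s = "- gap_root \<omega>" and ?\<rho> = "T11 \<omega> + gap_root \<omega>"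
  have "?s\<^sup>2 = T12 \<omega> * T21 \<omega>"
    using gap_root_props(1)[OF assms] by simp
  note step = eigenvector_floquet[OF this]
  \<comment> \<open>The two eigenvalues are inverse to each other, so for the eigenvector with
    \<open>- gap_root \<omega>\<close> a step to the left contracts by the same factor as a step to
    the right does for the other one.\<close>
  have inv: "?\<rho> * (T11 \<omega> + ?s) = 1"
    using gap_root_props(5)[OF assms] by simp
  have "comb_u (T12 \<omega>) ?s \<omega> x = ?\<rho> * comb_u (T12 \<omega>) ?s \<omega> (x + 1)"
    "comb_v (T12 \<omega>) ?s \<omega> x = ?\<rho> * comb_v (T12 \<omega>) ?s \<omega> (x + 1)" for x
    unfolding step mult.assoc[symmetric] inv by simp_all
  note step' = this
  have "(comb_u (T12 \<omega>) ?s \<omega> \<longlongrightarrow> 0) at_bot"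
    by (rule tendsto_at_bot_of_multiplier[OF comb_continuous(1) _ gap_root_props(4)[OF assms]]) (rule step')
  moreover have "(comb_v (T12 \<omega>) ?s \<omega> \<longlongrightarrow> 0) at_bot"
    by (rule tendsto_at_bot_of_multiplier[OF comb_continuous(2) _ gap_root_props(4)[OF assms]]) (rule step')
  ultimately show ?thesis
    by (rule comb_decays_along)
qed

end

section \<open>Uniqueness of the decaying solutions and the surface impedances\<close>

lemma multiplier_of_nat:
  fixes f :: "real \<Rightarrow> complex"
  assumes "\<And>x. f (x + 1) = \<rho> * f x"
  shows "f (x + real n) = \<rho> ^ n * f x"
proof (induction n)
  case (Suc n)
  then show ?case
    using assms[of "x + real n"] by (simp add: algebra_simps)
qed simp

text \<open>After multiplication by \<open>\<rho> ^ n\<close> the second term is the constant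
  \<open>B\<close>, while everything else tends to 0.\<close>

lemma growing_coefficient_zero:
  fixes A B \<rho> \<rho>' :: complex
  assumes lim: "(\<lambda>n. A * \<rho> ^ n + B * \<rho>' ^ n) \<longlonglongrightarrow> 0" and \<rho>: "norm \<rho> < 1" "\<rho> * \<rho>' = 1"
  shows "B = 0"
proof -
  have \<rho>0: "(\<lambda>n. \<rho> ^ n) \<longlonglongrightarrow> 0"
    using \<rho>(1) by (rule LIMSEQ_power_zero)
  have "(\<lambda>n. \<rho> ^ n * (A * \<rho> ^ n + B * \<rho>' ^ n) - A * (\<rho> ^ n * \<rho> ^ n)) \<longlonglongrightarrow> 0 * 0 - A * (0 * 0)"
    by (intro tendsto_intros lim \<rho>0)
  moreover have "\<rho> ^ n * (A * \<rho> ^ n + B * \<rho>' ^ n) - A * (\<rho> ^ n * \<rho> ^ n) = B" for n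
  proof -
    have "\<rho> ^ n * \<rho>' ^ n = 1"
      using \<rho>(2) by (simp flip: power_mult_distrib)
    moreover have "\<rho> ^ n * (A * \<rho> ^ n + B * \<rho>' ^ n) - A * (\<rho> ^ n * \<rho> ^ n) = B * (\<rho> ^ n * \<rho>' ^ n)"
      by (simp add: algebra_simps)
    ultimately show ?thesis
      by simp
  qed
  ultimately show ?thesis
    by (simp add: LIMSEQ_const_iff)
qed

context permittivity_medium
begin

text \<open>The data \<open>(p, q)\<close> are split into the eigenvectors (b, s) and (b, - s), both
  of which have u = b at \<open>x0\<close>. Each part is multiplied by its eigenvalue per period,
  and the inverse eigenvalues exchange their roles to the left. These lattice values already detect
  a growing part.\<close>

lemma comb_lattice:
  assumes "T11 \<omega> \<notin> complex_of_real ` {-1..1}"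
  defines "s \<equiv> gap_root \<omega>" and "b \<equiv> T12 \<omega>" and "a \<equiv> T11 \<omega>"
  shows "comb_u p q \<omega> (x0 + real n) = (p + q * b / s) / 2 * (a + s) ^ n + (p - q * b / s) / 2 * (a - s) ^ n"
    and "comb_u p q \<omega> (x0 - real n) = (p - q * b / s) / 2 * (a + s) ^ n + (p + q * b / s) / 2 * (a - s) ^ n"
proof -
  note props = gap_root_props[OF assms(1), folded s_def b_def a_def]
  have "s\<^sup>2 = T12 \<omega> * T21 \<omega>" "(- s)\<^sup>2 = T12 \<omega> * T21 \<omega>"
    using props(1) by (simp_all add: b_def)
  note step = this[THEN eigenvector_floquet(1), folded b_def a_def]
  have split: "comb_u p q \<omega> x = (p / b + q / s) / 2 * comb_u b s \<omega> x + (p / b - q / s) / 2 * comb_u b (- s) \<omega> x" for x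
    using props(2,3) by (simp add: field_simps)
  have pow: "comb_u b s \<omega> (x + real n) = (a + s) ^ n * comb_u b s \<omega> x"
    "comb_u b (- s) \<omega> (x + real n) = (a - s) ^ n * comb_u b (- s) \<omega> x" for x
    using multiplier_of_nat[of "comb_u b s \<omega>" "a + s" x n] multiplier_of_nat[of "comb_u b (- s) \<omega>" "a - s" x n]
      step by simp_all
  have inv: "(a + s) ^ n * (a - s) ^ n = 1"
    using props(5) by (simp flip: power_mult_distrib)
  have up: "comb_u b s \<omega> (x0 + real n) = (a + s) ^ n * b" "comb_u b (- s) \<omega> (x0 + real n) = (a - s) ^ n * b"
    using pow[of x0] by simp_all
  have cancel: "z = Q * b" if "b = P * z" "P * Q = 1" for z P Q
    using that by algebra
  have down: "comb_u b s \<omega> (x0 - real n) = (a - s) ^ n * b" "comb_u b (- s) \<omega> (x0 - real n) = (a + s) ^ n * b"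
  proof -
    have b: "b = (a + s) ^ n * comb_u b s \<omega> (x0 - real n)" "b = (a - s) ^ n * comb_u b (- s) \<omega> (x0 - real n)"
      using pow[of "x0 - real n"] by simp_all
    have inv': "(a - s) ^ n * (a + s) ^ n = 1"
      using inv by (simp add: mult.commute)
    show "comb_u b s \<omega> (x0 - real n) = (a - s) ^ n * b" "comb_u b (- s) \<omega> (x0 - real n) = (a + s) ^ n * b"
      by (rule cancel[OF b(1) inv], rule cancel[OF b(2) inv'])
  qed
  show "comb_u p q \<omega> (x0 + real n) = (p + q * b / s) / 2 * (a + s) ^ n + (p - q * b / s) / 2 * (a - s) ^ n"
    unfolding split[of "x0 + real n"] up using props(2,3) by (simp add: field_simps)
  show "comb_u p q \<omega> (x0 - real n) = (p - q * b / s) / 2 * (a + s) ^ n + (p + q * b / s) / 2 * (a - s) ^ n"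
    unfolding split[of "x0 - real n"] down using props(2,3) by (simp add: field_simps)
qed

lemma decaying_unique_at_top:
  assumes gap: "T11 \<omega> \<notin> complex_of_real ` {-1..1}" and lim: "(comb_u p q \<omega> \<longlongrightarrow> 0) at_top"
  shows "p * gap_root \<omega> = q * T12 \<omega>"
proof -
  have "filterlim (\<lambda>n. x0 + real n) at_top sequentially"
    by (rule filterlim_tendsto_add_at_top[OF tendsto_const filterlim_real_sequentially])
  from filterlim_compose[OF lim this] have "(p - q * T12 \<omega> / gap_root \<omega>) / 2 = 0"
    unfolding comb_lattice(1)[OF gap] by (rule growing_coefficient_zero) (use gap_root_props[OF gap] in auto)
  then show ?thesis
    using gap_root_props(2)[OF gap] by (simp add: field_simps)
qed

lemma decaying_unique_at_bot:
  assumes gap: "T11 \<omega> \<notin> complex_of_real ` {-1..1}" and lim: "(comb_u p q \<omega> \<longlongrightarrow> 0) at_bot"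
  shows "p * gap_root \<omega> = - (q * T12 \<omega>)"
proof -
  have "filterlim (\<lambda>n. - x0 + real n) at_top sequentially"
    by (rule filterlim_tendsto_add_at_top[OF tendsto_const filterlim_real_sequentially])
  then have "filterlim (\<lambda>n. x0 - real n) at_bot sequentially"
    by (simp add: filterlim_uminus_at_bot)
  from filterlim_compose[OF lim this] have "(p + q * T12 \<omega> / gap_root \<omega>) / 2 = 0"
    unfolding comb_lattice(2)[OF gap] by (rule growing_coefficient_zero) (use gap_root_props[OF gap] in auto)
  then show ?thesis
    using gap_root_props(2)[OF gap] by (simp add: field_simps add_eq_0_iff)
qed

text \<open>The limit of the derivative is the limit of \<open>eps\<close> times the flux
  \<open>q\<close> at \<open>x0\<close>, so the one-sided limit of \<open>eps\<close> cancels, even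
  if \<open>x0\<close> is a breakpoint.\<close>

lemma impedance_quotient:
  assumes F: "F \<le> at x0" "F \<noteq> bot" and eps: "(eps \<longlongrightarrow> l) F" "l \<noteq> 0"
  shows "Lim F (comb_u p q \<omega>) /
    (1 / Lim F eps * Lim F (\<lambda>x. vector_derivative (comb_u p q \<omega>) (at x))) = p / q"
proof -
  have tends: "(f \<longlongrightarrow> f x0) F" if "continuous_on UNIV f" for f :: "real \<Rightarrow> complex"
    using that F(1) by (intro tendsto_mono[OF F(1)]) (simp add: continuous_on_def)
  have u: "Lim F (comb_u p q \<omega>) = p"
    using tends[OF comb_continuous(1), of p \<omega> q] by (intro tendsto_Lim F(2)) simp
  have v: "((\<lambda>x. eps x * comb_v p q \<omega> x) \<longlongrightarrow> l * q) F"
    using tends[OF comb_continuous(2), of p \<omega> q] by (intro tendsto_mult eps(1)) simp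
  have "\<forall>\<^sub>F x in F. x \<notin> breakpoints eps"
    by (rule filter_leD[OF F(1) locally_finite_set_eventually[OF breakpoints_locally_finite]])
  then have "\<forall>\<^sub>F x in F. eps x * comb_v p q \<omega> x = vector_derivative (comb_u p q \<omega>) (at x)"
    by eventually_elim (rule vector_derivative_at[OF comb_u_derivative, symmetric])
  then have "Lim F (\<lambda>x. vector_derivative (comb_u p q \<omega>) (at x)) = l * q"
    using v by (intro tendsto_Lim F(2)) (rule Lim_transform_eventually)
  moreover have "Lim F eps = l"
    by (rule tendsto_Lim[OF F(2) eps(1)])
  ultimately show ?thesis
    using eps(2) u by simp
qed

text \<open>The solution picked by \<open>SOME\<close> may differ from the one exhibited in the
  hypotheses. It suffices that it is a nontrivial combination tending to 0: the impedance depends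
  only on the ratio of \<open>p\<close> and \<open>q\<close>, which the decay determines.\<close>

lemma decaying_solution_comb:
  assumes "comb_u p0 q0 \<omega> x \<noteq> 0" "decays_along F eps (comb_u p0 q0 \<omega>)"
  obtains p q where "decaying_solution mu0 F eps \<omega> = comb_u p q \<omega>" "p \<noteq> 0 \<or> q \<noteq> 0"
    "(comb_u p q \<omega> \<longlongrightarrow> 0) F"
proof -
  let ?P = "\<lambda>u. solution mu0 eps \<omega> u \<and> (\<exists>x. u x \<noteq> 0) \<and> decays_along F eps u"
  have "?P (comb_u p0 q0 \<omega>)"
    using assms comb_solution by blast
  then have P: "?P (decaying_solution mu0 F eps \<omega>)"
    unfolding decaying_solution_def by (rule someI[where P = ?P])
  then obtain p q where pq: "decaying_solution mu0 F eps \<omega> = comb_u p q \<omega>"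
    using solution_imp_comb by blast
  have comb: "?P (comb_u p q \<omega>)"
    using P pq by simp
  then have "p \<noteq> 0 \<or> q \<noteq> 0"
    by auto
  then show ?thesis
    using that[OF pq] comb unfolding decays_along_def by blast
qed

lemma Z_B_eq:
  assumes gap: "T11 \<omega> \<notin> complex_of_real ` {-1..1}"
  shows "Z_B mu0 x0 eps \<omega> = T12 \<omega> / gap_root \<omega>"
proof -
  note props = gap_root_props[OF gap]
  have "comb_u (T12 \<omega>) (gap_root \<omega>) \<omega> x0 \<noteq> 0"
    using props(3) by simp
  then obtain p q where pq: "decaying_solution mu0 at_top eps \<omega> = comb_u p q \<omega>" "p \<noteq> 0 \<or> q \<noteq> 0"
    "(comb_u p q \<omega> \<longlongrightarrow> 0) at_top"
    using decaying_solution_comb[OF _ decaying_at_top[OF gap]] by blast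
  have eq: "p * gap_root \<omega> = q * T12 \<omega>"
    by (rule decaying_unique_at_top[OF gap pq(3)])
  obtain l where l: "(eps \<longlongrightarrow> l) (at_right x0)"
    using permittivity unfolding permittivity_def has_one_sided_limits_def by blast
  have "Lim (at_right x0) eps = l"
    by (rule tendsto_Lim[OF _ l]) simp
  then have "0 < Re l"
    using permittivity unfolding permittivity_def by blast
  then have "l \<noteq> 0"
    by auto
  then have "Z_B mu0 x0 eps \<omega> = p / q"
    unfolding Z_B_def Let_def pq(1) using l by (intro impedance_quotient) (auto simp: at_le)
  moreover have "q \<noteq> 0"
    using eq props(2) pq(2) by auto
  then have "p / q = T12 \<omega> / gap_root \<omega>"
    using eq props(2) by (simp add: frac_eq_eq mult.commute)
  ultimately show ?thesis
    by simp
qed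

lemma Z_A_eq:
  assumes gap: "T11 \<omega> \<notin> complex_of_real ` {-1..1}"
  shows "Z_A mu0 x0 eps \<omega> = T12 \<omega> / gap_root \<omega>"
proof -
  note props = gap_root_props[OF gap]
  have "comb_u (T12 \<omega>) (- gap_root \<omega>) \<omega> x0 \<noteq> 0"
    using props(3) by simp
  then obtain p q where pq: "decaying_solution mu0 at_bot eps \<omega> = comb_u p q \<omega>" "p \<noteq> 0 \<or> q \<noteq> 0"
    "(comb_u p q \<omega> \<longlongrightarrow> 0) at_bot"
    using decaying_solution_comb[OF _ decaying_at_bot[OF gap]] by blast
  have eq: "p * gap_root \<omega> = - (q * T12 \<omega>)"
    by (rule decaying_unique_at_bot[OF gap pq(3)])
  obtain l where l: "(eps \<longlongrightarrow> l) (at_left x0)"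
    using permittivity unfolding permittivity_def has_one_sided_limits_def by blast
  have "Lim (at_left x0) eps = l"
    by (rule tendsto_Lim[OF _ l]) simp
  then have "0 < Re l"
    using permittivity unfolding permittivity_def by blast
  then have "l \<noteq> 0"
    by auto
  then have "Z_A mu0 x0 eps \<omega> = - (p / q)"
    unfolding Z_A_def Let_def pq(1) using l by (subst impedance_quotient) (auto simp: at_le)
  moreover have "q \<noteq> 0"
    using eq props(2) pq(2) by auto
  then have "p / q = - T12 \<omega> / gap_root \<omega>"
    using eq props(2) by (subst frac_eq_eq) (simp_all add: mult.commute)
  ultimately show ?thesis
    by simp
qed

end

section \<open>Sign of the imaginary part of the undamped surface impedance\<close>

context permittivity_medium
begin

text \<open>For a decaying Floquet solution \<open>u\<close> with flux \<open>v\<close>, the function \<open>Im (u * cnj v)\<close> is multiplied by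
  the squared modulus of the multiplier over one period, while its derivative is
  \<open>mu0 * Im \<omega>\<^sup>2 * \<bar>u\<bar>\<^sup>2\<close>. This fixes the sign of \<open>Im (u / v)\<close>.\<close>

lemma impedance_Im_sign:
  assumes real: "\<And>x. eps x \<in> \<real>" and gap: "T11 \<omega> \<notin> complex_of_real ` {-1..1}"
    and nonreal: "Im (\<omega>\<^sup>2) \<noteq> 0"
  shows "Im (\<omega>\<^sup>2) * Im (T12 \<omega> / gap_root \<omega>) < 0"
proof -
  define b s \<rho> where "b = T12 \<omega>" and "s = gap_root \<omega>" and "\<rho> = T11 \<omega> + s"
  note props = gap_root_props[OF gap, folded s_def b_def, folded \<rho>_def]
  define u v where "u = comb_u b s \<omega>" and "v = comb_v b s \<omega>"
  define W where "W x = Im (u x * cnj (v x))" for x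
  define g where "g x = mu0 * Im (\<omega>\<^sup>2) * (norm (u x))\<^sup>2" for x
  note cont = comb_continuous[of b \<omega> s, folded u_def v_def]
  have step: "u (x + 1) = \<rho> * u x" "v (x + 1) = \<rho> * v x" for x
    unfolding u_def v_def b_def \<rho>_def
    by (rule eigenvector_floquet, use props(1) in \<open>simp add: b_def\<close>)+
  have base: "u x0 = b" "v x0 = s"
    by (simp_all add: u_def v_def)
  have deriv: "(W has_vector_derivative g x) (at x)" if x: "x \<notin> breakpoints eps" for x
  proof -
    have du: "(u has_vector_derivative eps x * v x) (at x)"
      unfolding u_def v_def by (rule comb_u_derivative[OF x])
    have dv: "(v has_vector_derivative - complex_of_real mu0 * \<omega>\<^sup>2 * u x) (at x)"
      unfolding u_def v_def by (rule comb_v_derivative)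
    have "((\<lambda>x. u x * cnj (v x)) has_vector_derivative
        u x * cnj (- complex_of_real mu0 * \<omega>\<^sup>2 * u x) + eps x * v x * cnj (v x)) (at x)"
      by (intro has_vector_derivative_mult du has_vector_derivative_cnj dv)
    then have "((\<lambda>x. Im (u x * cnj (v x))) has_vector_derivative
        Im (u x * cnj (- complex_of_real mu0 * \<omega>\<^sup>2 * u x) + eps x * v x * cnj (v x))) (at x)"
      by (rule bounded_linear.has_vector_derivative[OF bounded_linear_Im])
    moreover have "Im (eps x * v x * cnj (v x)) = 0"
      using real[of x] by (auto elim!: Reals_cases)
    moreover have "Im (u x * cnj (- complex_of_real mu0 * \<omega>\<^sup>2 * u x)) = g x"
      unfolding g_def cmod_power2 by (simp add: power2_eq_square algebra_simps)
    ultimately show ?thesis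
      unfolding W_def by simp
  qed
  have "continuous_on {x0..x0 + 1} W"
    unfolding W_def by (intro continuous_intros continuous_on_subset[OF cont(1)] continuous_on_subset[OF cont(2)]) auto
  then have "(g has_integral W (x0 + 1) - W x0) {x0..x0 + 1}"
    using breakpoints_locally_finite deriv
    by (intro fundamental_theorem_of_calculus_interior_strong[where S = "breakpoints eps \<inter> {x0..x0 + 1}"])
      (auto simp: locally_finite_set_def)
  moreover have "W (x0 + 1) = (norm \<rho>)\<^sup>2 * W x0"
  proof -
    have "u (x0 + 1) * cnj (v (x0 + 1)) = (\<rho> * cnj \<rho>) * (u x0 * cnj (v x0))"
      unfolding step by simp
    also have "\<rho> * cnj \<rho> = complex_of_real ((norm \<rho>)\<^sup>2)"
      by (rule complex_norm_square[symmetric])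
    finally show ?thesis
      by (simp add: W_def)
  qed
  ultimately have "(g has_integral ((norm \<rho>)\<^sup>2 - 1) * W x0) {x0..x0 + 1}"
    by (simp add: algebra_simps)
  from has_integral_mult_right[OF this, of "Im (\<omega>\<^sup>2)"]
  have int: "((\<lambda>x. Im (\<omega>\<^sup>2) * g x) has_integral Im (\<omega>\<^sup>2) * (((norm \<rho>)\<^sup>2 - 1) * W x0)) {x0..x0 + 1}" .
  have g: "Im (\<omega>\<^sup>2) * g x = mu0 * (Im (\<omega>\<^sup>2))\<^sup>2 * (norm (u x))\<^sup>2" for x
    by (simp add: g_def power2_eq_square)
  have nonneg: "0 \<le> Im (\<omega>\<^sup>2) * g x" for x
    unfolding g using mu0_pos by simp
  have "continuous_on {x0..x0 + 1} (\<lambda>x. Im (\<omega>\<^sup>2) * g x)"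
    unfolding g by (intro continuous_intros continuous_on_subset[OF cont(1)]) auto
  \<comment> \<open>Strictness: the integrand is continuous and nonnegative, and it is positive at
    \<open>x0\<close> because \<open>u x0 = b\<close> is nonzero in the gap.\<close>
  moreover have "Im (\<omega>\<^sup>2) * g x0 \<noteq> 0"
    unfolding g base using mu0_pos nonreal props(3) by simp
  ultimately have "integral {x0..x0 + 1} (\<lambda>x. Im (\<omega>\<^sup>2) * g x) \<noteq> 0"
    using integral_eq_0_iff[of x0 "x0 + 1" "\<lambda>x. Im (\<omega>\<^sup>2) * g x"] nonneg by auto
  then have "0 < Im (\<omega>\<^sup>2) * (((norm \<rho>)\<^sup>2 - 1) * W x0)"
    using has_integral_nonneg[OF int nonneg] integral_unique[OF int] by linarith
  then have "(1 - (norm \<rho>)\<^sup>2) * (Im (\<omega>\<^sup>2) * W x0) < 0"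
    by (simp add: algebra_simps)
  moreover have "0 < 1 - (norm \<rho>)\<^sup>2"
    using props(4) by (simp add: power_less_one_iff abs_square_less_1)
  ultimately have less: "Im (\<omega>\<^sup>2) * W x0 < 0"
    by (simp add: mult_less_0_iff)
  \<comment> \<open>The quotient is \<open>b * cnj s\<close> divided by the squared modulus of s,
    and \<open>b * cnj s\<close> is the value of \<open>u * cnj v\<close> at
    \<open>x0\<close>.\<close>
  have "Im (b / s) = W x0 / (norm s)\<^sup>2"
    by (simp add: W_def base complex_div_cnj[of b s] flip: of_real_power)
  then have "Im (\<omega>\<^sup>2) * Im (b / s) = Im (\<omega>\<^sup>2) * W x0 / (norm s)\<^sup>2"
    by simp
  also have "\<dots> < 0"
    using less props(2) by (intro divide_neg_pos) auto
  finally show ?thesis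
    by (simp add: b_def s_def)
qed

end

text \<open>In the gap the impedance is bA / sA + bB / sB with nonzero sA and sB. Clearing
  denominators keeps the zeros and leaves sums and products, whose uniform limits are easy to
  control. In the undamped case both summands have imaginary parts of the same strict sign when
  \<omega>^2 is not real, so they cannot cancel.\<close>

lemma
  fixes x0 mu0 MA MB :: real and epsA epsB :: "real \<Rightarrow> complex" and \<omega> :: complex
  assumes "permittivity_medium x0 mu0 epsA MA" "permittivity_medium x0 mu0 epsB MB"
  defines "aA \<equiv> fund_u1 x0 (- complex_of_real mu0) epsA \<omega> (x0 + 1)"
    and "aB \<equiv> fund_u1 x0 (- complex_of_real mu0) epsB \<omega> (x0 + 1)"
    and "bA \<equiv> fund_u2 x0 (- complex_of_real mu0) epsA \<omega> (x0 + 1)"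
    and "bB \<equiv> fund_u2 x0 (- complex_of_real mu0) epsB \<omega> (x0 + 1)"
  shows common_band_gap_iff: "\<omega> \<in> common_band_gap mu0 epsA epsB \<longleftrightarrow>
      aA \<notin> complex_of_real ` {-1..1} \<and> aB \<notin> complex_of_real ` {-1..1}"
    and interface_impedance_zero_iff: "\<omega> \<in> common_band_gap mu0 epsA epsB \<Longrightarrow>
      interface_impedance mu0 x0 epsA epsB \<omega> = 0 \<longleftrightarrow> bA * decay_root aB + bB * decay_root aA = 0"
    and interface_impedance_nonreal: "\<omega> \<in> common_band_gap mu0 epsA epsB \<Longrightarrow>
      (\<And>x. epsA x \<in> \<real>) \<Longrightarrow> (\<And>x. epsB x \<in> \<real>) \<Longrightarrow> Im (\<omega>\<^sup>2) \<noteq> 0 \<Longrightarrow>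
      interface_impedance mu0 x0 epsA epsB \<omega> \<noteq> 0"
proof -
  interpret A: permittivity_medium x0 mu0 epsA MA by fact
  interpret B: permittivity_medium x0 mu0 epsB MB by fact
  show iff: "\<omega> \<in> common_band_gap mu0 epsA epsB \<longleftrightarrow>
      aA \<notin> complex_of_real ` {-1..1} \<and> aB \<notin> complex_of_real ` {-1..1}"
    by (auto simp: common_band_gap_def A.floquet_bloch_spectrum_iff B.floquet_bloch_spectrum_iff
        aA_def aB_def)
  {
    assume gap: "\<omega> \<in> common_band_gap mu0 epsA epsB"
    note gapA = conjunct1[OF gap[unfolded iff], unfolded aA_def]
      and gapB = conjunct2[OF gap[unfolded iff], unfolded aB_def]
    have Z: "interface_impedance mu0 x0 epsA epsB \<omega> = bA / decay_root aA + bB / decay_root aB"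
      by (simp add: interface_impedance_def A.Z_A_eq[OF gapA] B.Z_B_eq[OF gapB] aA_def aB_def bA_def bB_def)
    have "decay_root aA \<noteq> 0" "decay_root aB \<noteq> 0"
      using A.gap_root_props(2)[OF gapA] B.gap_root_props(2)[OF gapB] by (simp_all add: aA_def aB_def)
    then show "interface_impedance mu0 x0 epsA epsB \<omega> = 0 \<longleftrightarrow> bA * decay_root aB + bB * decay_root aA = 0"
      unfolding Z by (simp add: add_frac_eq)
    assume "\<And>x. epsA x \<in> \<real>" "\<And>x. epsB x \<in> \<real>" "Im (\<omega>\<^sup>2) \<noteq> 0"
    from A.impedance_Im_sign[OF this(1) gapA this(3)] B.impedance_Im_sign[OF this(2) gapB this(3)]
    have "Im (\<omega>\<^sup>2) * Im (interface_impedance mu0 x0 epsA epsB \<omega>) < 0"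
      unfolding Z by (simp add: aA_def aB_def bA_def bB_def distrib_left)
    then show "interface_impedance mu0 x0 epsA epsB \<omega> \<noteq> 0"
      by auto
  }
qed

section \<open>Dependence of the transfer matrix on the frequency and on the permittivity\<close>

lemma fund_u1_holomorphic:
  assumes "weight M eps" "norm m \<le> M"
  shows "(\<lambda>\<omega>. fund_u1 x0 m eps \<omega> x) holomorphic_on S"
proof -
  let ?J = "\<lambda>n. iterated_primitive x0 eps (\<lambda>_. m) n x"
  have "(\<lambda>\<omega>. fund_u1 x0 m eps \<omega> x) holomorphic_on ball (0 :: complex) r" for r
  proof (rule power_series_holomorphic)
    fix \<omega> :: complex
    have "(\<lambda>n. even_powers \<omega> n * ?J n) sums fund_u1 x0 m eps \<omega> x"
      unfolding fund_u1_def iterated_series_def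
      using assms by (intro summable_sums iterated_series_summable[of M] weight_const geometric_growth_even_powers)
    moreover have "(\<lambda>n. even_powers \<omega> n * ?J n) = (\<lambda>n. (if even n then ?J n else 0) * (\<omega> - 0) ^ n)"
      by (auto simp: even_powers_def)
    ultimately show "(\<lambda>n. (if even n then ?J n else 0) * (\<omega> - 0) ^ n) sums fund_u1 x0 m eps \<omega> x"
      by metis
  qed
  then have "(\<lambda>\<omega>. fund_u1 x0 m eps \<omega> x) field_differentiable (at \<omega>)" for \<omega>
    by (rule holomorphic_on_imp_differentiable_at[OF _ open_ball, of _ 0 "norm \<omega> + 1"]) simp
  then show ?thesis
    using holomorphic_on_def field_differentiable_at_within by blast
qed

lemma fund_u2_holomorphic:
  assumes "weight M eps" "norm m \<le> M"
  shows "(\<lambda>\<omega>. fund_u2 x0 m eps \<omega> x) holomorphic_on S"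
proof -
  let ?J = "\<lambda>n. iterated_primitive x0 eps (\<lambda>_. m) n x"
  have "(\<lambda>\<omega>. fund_u2 x0 m eps \<omega> x) holomorphic_on ball (0 :: complex) r" for r
  proof (rule power_series_holomorphic)
    fix \<omega> :: complex
    have "(\<lambda>n. odd_powers \<omega> n * ?J n) sums fund_u2 x0 m eps \<omega> x"
      unfolding fund_u2_def iterated_series_def
      using assms by (intro summable_sums iterated_series_summable[of M] weight_const geometric_growth_odd_powers)
    \<comment> \<open>The term with index 0 is zero; after this shift of the index the exponent n -
      1 becomes n.\<close>
    then have "(\<lambda>n. odd_powers \<omega> (Suc n) * ?J (Suc n)) sums fund_u2 x0 m eps \<omega> x"
      by (subst sums_Suc_iff) (simp add: odd_powers_def)
    moreover have "(\<lambda>n. odd_powers \<omega> (Suc n) * ?J (Suc n)) = (\<lambda>n. (if even n then ?J (Suc n) else 0) * (\<omega> - 0) ^ n)"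
      by (auto simp: odd_powers_def)
    ultimately show "(\<lambda>n. (if even n then ?J (Suc n) else 0) * (\<omega> - 0) ^ n) sums fund_u2 x0 m eps \<omega> x"
      by metis
  qed
  then have "(\<lambda>\<omega>. fund_u2 x0 m eps \<omega> x) field_differentiable (at \<omega>)" for \<omega>
    by (rule holomorphic_on_imp_differentiable_at[OF _ open_ball, of _ 0 "norm \<omega> + 1"]) simp
  then show ?thesis
    using holomorphic_on_def field_differentiable_at_within by blast
qed

text \<open>The factor n in \<open>iterated_primitive_diff_bound\<close> is absorbed by n \<le> 2^n,
  which leaves \<eta> times the exponential series of 2 R M. The coefficients enter only through R,
  so the bound is uniform for frequencies in a ball.\<close>

lemma iterated_series_perturbation:
  assumes \<alpha>: "weight M \<alpha>" "weight M \<alpha>'" and m: "norm m \<le> M" and M: "1 \<le> M"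
    and diff: "\<And>x. norm (\<alpha>' x - \<alpha> x) \<le> \<eta>"
    and c: "\<And>n. norm (c n) \<le> R ^ n" and R: "0 \<le> R"
  shows "norm (iterated_series x0 c \<alpha>' (\<lambda>_. m) (x0 + 1) - iterated_series x0 c \<alpha> (\<lambda>_. m) (x0 + 1))
    \<le> \<eta> * (\<Sum>n. inverse (fact n) * (2 * R * M) ^ n)"
proof -
  let ?J = "\<lambda>n. iterated_primitive x0 \<alpha> (\<lambda>_. m) n (x0 + 1)"
  let ?J' = "\<lambda>n. iterated_primitive x0 \<alpha>' (\<lambda>_. m) n (x0 + 1)"
  note \<beta> = weight_const[OF m]
  have \<eta>: "0 \<le> \<eta>"
    using diff norm_ge_zero order_trans by blast
  have growth: "geometric_growth c"
    unfolding geometric_growth_def using c R by (intro exI[of _ 1] exI[of _ R]) simp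
  have bound: "norm (c n * ?J' n - c n * ?J n) \<le> \<eta> * (inverse (fact n) * (2 * R * M) ^ n)" for n
  proof -
    have "norm (?J' n - ?J n) \<le> \<eta> * (n * M ^ n * \<bar>x0 + 1 - x0\<bar> ^ n / fact n)"
      by (rule iterated_primitive_diff_bound[OF \<alpha>(1) \<beta> \<alpha>(2) \<beta> M diff]) (simp add: \<eta>)
    also have "\<dots> \<le> \<eta> * (2 ^ n * M ^ n / fact n)"
      using \<eta> M of_nat_less_two_power[of n, where 'a = real]
      by (auto intro!: mult_left_mono divide_right_mono mult_right_mono)
    finally have "norm (c n) * norm (?J' n - ?J n) \<le> R ^ n * (\<eta> * (2 ^ n * M ^ n / fact n))"
      using c R by (intro mult_mono) auto
    also have "\<dots> = \<eta> * (inverse (fact n) * (2 * R * M) ^ n)"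
      by (simp add: power_mult_distrib divide_inverse mult_ac)
    finally show ?thesis
      unfolding right_diff_distrib[symmetric] norm_mult .
  qed
  have sum: "summable (\<lambda>n. \<eta> * (inverse (fact n) * (2 * R * M) ^ n))"
    by (intro summable_mult summable_exp)
  have "iterated_series x0 c \<alpha>' (\<lambda>_. m) (x0 + 1) - iterated_series x0 c \<alpha> (\<lambda>_. m) (x0 + 1) =
      (\<Sum>n. c n * ?J' n - c n * ?J n)"
    unfolding iterated_series_def
    by (intro suminf_diff iterated_series_summable[OF _ \<beta> growth] \<alpha>)
  also have "norm \<dots> \<le> (\<Sum>n. \<eta> * (inverse (fact n) * (2 * R * M) ^ n))"
    by (rule norm_suminf_le[OF bound sum])
  also have "\<dots> = \<eta> * (\<Sum>n. inverse (fact n) * (2 * R * M) ^ n)"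
    by (intro suminf_mult summable_exp)
  finally show ?thesis .
qed

section \<open>The limit of vanishing damping\<close>

text \<open>Damping leaves the real part unchanged, so the perturbation is purely imaginary and
  \<eta> can be the supremum of its modulus. That supremum bounds the values because each
  permittivity is bounded.\<close>

lemma damped_family_bound:
  assumes "damped_family x0 eps"
  obtains \<eta> M where "(\<eta> \<longlongrightarrow> 0) (at_right 0)" "\<And>x. norm (eps 0 x) \<le> M"
    "\<And>\<delta> x. 0 \<le> \<delta> \<Longrightarrow> norm (eps \<delta> x - eps 0 x) \<le> \<eta> \<delta>"
proof -
  have perm: "permittivity x0 (eps \<delta>)" if "0 \<le> \<delta>" for \<delta>
    using assms that by (auto simp: damped_family_def)
  obtain M where M: "\<And>x. norm (eps 0 x) \<le> M"
    using permittivity_bounded[OF perm[of 0]] by auto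
  have "norm (eps \<delta> x - eps 0 x) \<le> (SUP x. \<bar>Im (eps \<delta> x)\<bar>)" if \<delta>: "0 \<le> \<delta>" for \<delta> x
  proof -
    have "eps 0 x = complex_of_real (Re (eps \<delta> x))"
      using assms \<delta> by (simp add: damped_family_def)
    then have "eps \<delta> x - eps 0 x = \<i> * complex_of_real (Im (eps \<delta> x))"
      by (simp add: complex_eq_iff)
    then have "norm (eps \<delta> x - eps 0 x) = \<bar>Im (eps \<delta> x)\<bar>"
      by (simp add: norm_mult)
    also obtain K where "\<And>x. norm (eps \<delta> x) \<le> K"
      using permittivity_bounded[OF perm[OF \<delta>]] by auto
    then have "bdd_above (range (\<lambda>x. \<bar>Im (eps \<delta> x)\<bar>))"
      by (meson abs_Im_le_cmod bdd_aboveI2 order_trans)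
    then have "\<bar>Im (eps \<delta> x)\<bar> \<le> (SUP x. \<bar>Im (eps \<delta> x)\<bar>)"
      by (intro cSUP_upper) auto
    finally show ?thesis .
  qed
  then show ?thesis
    using that M assms unfolding damped_family_def by blast
qed

lemma damped_family_limits:
  assumes "0 < mu0" and fam: "damped_family x0 eps"
  defines "m \<equiv> - complex_of_real mu0"
  obtains M where "permittivity_medium x0 mu0 (eps 0) M"
    "\<forall>\<^sub>F \<delta> in at_right 0. permittivity_medium x0 mu0 (eps \<delta>) M"
    "\<And>R. 0 \<le> R \<Longrightarrow> uniform_limit (ball 0 R) (\<lambda>\<delta> \<omega>. fund_u1 x0 m (eps \<delta>) \<omega> (x0 + 1))
       (\<lambda>\<omega>. fund_u1 x0 m (eps 0) \<omega> (x0 + 1)) (at_right 0)"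
    "\<And>R. 0 \<le> R \<Longrightarrow> uniform_limit (ball 0 R) (\<lambda>\<delta> \<omega>. fund_u2 x0 m (eps \<delta>) \<omega> (x0 + 1))
       (\<lambda>\<omega>. fund_u2 x0 m (eps 0) \<omega> (x0 + 1)) (at_right 0)"
proof -
  obtain \<eta> M0 where \<eta>: "(\<eta> \<longlongrightarrow> 0) (at_right 0)" and M0: "\<And>x. norm (eps 0 x) \<le> M0"
    and diff: "\<And>\<delta> x. 0 \<le> \<delta> \<Longrightarrow> norm (eps \<delta> x - eps 0 x) \<le> \<eta> \<delta>"
    using damped_family_bound[OF fam] by blast
  \<comment> \<open>\<open>M\<close> has to bound \<open>mu0\<close> as a constant weight, be at
    least 1 for the perturbation estimate, and exceed the undamped bound by 1 to cover every
    \<delta> with \<open>\<eta> \<delta> < 1\<close>.\<close>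
  define M where "M = max mu0 (max 1 (M0 + 1))"
  have M: "mu0 \<le> M" "1 \<le> M" "M0 + 1 \<le> M"
    by (simp_all add: M_def)
  have m: "norm m \<le> M"
    using M(1) \<open>0 < mu0\<close> by (simp add: m_def)
  have medium: "permittivity_medium x0 mu0 (eps \<delta>) M" if "0 \<le> \<delta>" "\<And>x. norm (eps \<delta> x) \<le> M" for \<delta>
    using that \<open>0 < mu0\<close> M(1) fam by unfold_locales (auto simp: damped_family_def)
  have "norm (eps 0 x) \<le> M" for x
    using M0[of x] M(3) by linarith
  then have med0: "permittivity_medium x0 mu0 (eps 0) M"
    by (intro medium) auto
  have pos: "\<forall>\<^sub>F \<delta> in at_right (0::real). 0 < \<delta>"
    by (simp add: eventually_at_right_less)
  moreover have "\<forall>\<^sub>F \<delta> in at_right 0. \<eta> \<delta> < 1"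
    using \<eta> by (rule order_tendstoD) simp
  ultimately have med: "\<forall>\<^sub>F \<delta> in at_right 0. permittivity_medium x0 mu0 (eps \<delta>) M"
  proof eventually_elim
    case (elim \<delta>)
    have "norm (eps \<delta> x) \<le> M" for x
      using norm_triangle_sub[of "eps \<delta> x" "eps 0 x"] M0[of x] diff[of \<delta> x] elim M(3) by linarith
    then show ?case
      using elim by (intro medium) auto
  qed
  have weight: "weight M e" if "permittivity_medium x0 mu0 e M" for e
  proof -
    interpret permittivity_medium x0 mu0 e M by fact
    show ?thesis by (rule weight_eps)
  qed
  have lim: "uniform_limit (ball 0 R) (\<lambda>\<delta> \<omega>. iterated_series x0 (c \<omega>) (eps \<delta>) (\<lambda>_. m) (x0 + 1))
       (\<lambda>\<omega>. iterated_series x0 (c \<omega>) (eps 0) (\<lambda>_. m) (x0 + 1)) (at_right 0)"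
    if c: "\<And>\<omega> n. norm (c \<omega> n) \<le> (1 + norm \<omega>) ^ n" and R: "0 \<le> R" for c :: "complex \<Rightarrow> nat \<Rightarrow> complex" and R
  proof (rule uniform_limitI)
    fix e :: real assume "0 < e"
    define C where "C = (\<Sum>n. inverse (fact n) * (2 * (1 + R) * M) ^ n)"
    have "((\<lambda>\<delta>. \<eta> \<delta> * C) \<longlongrightarrow> 0 * C) (at_right 0)"
      by (intro tendsto_mult \<eta> tendsto_const)
    then have "\<forall>\<^sub>F \<delta> in at_right 0. \<eta> \<delta> * C < e"
      using \<open>0 < e\<close> by (auto intro: order_tendstoD)
    then show "\<forall>\<^sub>F \<delta> in at_right 0. \<forall>\<omega>\<in>ball 0 R.
        dist (iterated_series x0 (c \<omega>) (eps \<delta>) (\<lambda>_. m) (x0 + 1))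
          (iterated_series x0 (c \<omega>) (eps 0) (\<lambda>_. m) (x0 + 1)) < e"
      using pos med
    proof eventually_elim
      case (elim \<delta>)
      show ?case
      proof
        fix \<omega> :: complex assume \<omega>: "\<omega> \<in> ball 0 R"
        have "norm (c \<omega> n) \<le> (1 + R) ^ n" for n
        proof -
          have "(1 + norm \<omega>) ^ n \<le> (1 + R) ^ n"
            using \<omega> by (intro power_mono) auto
          then show ?thesis
            using c[of \<omega> n] by linarith
        qed
        from iterated_series_perturbation[OF weight[OF med0] weight[OF elim(3)] m M(2) diff this]
        have "norm (iterated_series x0 (c \<omega>) (eps \<delta>) (\<lambda>_. m) (x0 + 1) -
            iterated_series x0 (c \<omega>) (eps 0) (\<lambda>_. m) (x0 + 1)) \<le> \<eta> \<delta> * C"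
          using elim(2) R by (simp add: C_def)
        then show "dist (iterated_series x0 (c \<omega>) (eps \<delta>) (\<lambda>_. m) (x0 + 1))
            (iterated_series x0 (c \<omega>) (eps 0) (\<lambda>_. m) (x0 + 1)) < e"
          using elim(1) by (simp add: dist_norm)
      qed
    qed
  qed
  show ?thesis
    using that[OF med0 med] lim[of even_powers] lim[of odd_powers] even_powers_bound odd_powers_bound
    unfolding fund_u1_def fund_u2_def by blast
qed

section \<open>Persistence of roots and choice of a convergent one\<close>

lemma compact_real_segment: "compact (complex_of_real ` {-1..1})"
  by (intro compact_continuous_image continuous_intros) auto

text \<open>To be applied with \<open>U\<close> the complement of [-1, 1]: near \<open>c\<close> the
  diagonal entry stays in a compact subset of \<open>U\<close>, for the limit and eventually along
  the filter. There \<open>decay_root\<close> is uniformly continuous, so composing with it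
  preserves uniform convergence.\<close>

lemma uniform_limit_in_compact:
  fixes a :: "'a \<Rightarrow> complex \<Rightarrow> complex"
  assumes lim: "uniform_limit (ball 0 R) a a0 F" and cont: "isCont a0 c" and c: "c \<in> ball 0 R"
    and U: "open U" "a0 c \<in> U"
  obtains r K where "0 < r" "ball c r \<subseteq> ball 0 R" "compact K" "K \<subseteq> U" "a0 ` ball c r \<subseteq> K"
    "\<forall>\<^sub>F n in F. a n ` ball c r \<subseteq> K"
proof -
  obtain e where e: "0 < e" "cball (a0 c) e \<subseteq> U"
    using U open_contains_cball by blast
  obtain d where d: "0 < d" "\<And>\<omega>. dist \<omega> c < d \<Longrightarrow> dist (a0 \<omega>) (a0 c) < e / 2"
    using cont e(1) unfolding continuous_at_eps_delta by (metis half_gt_zero)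
  obtain d' where d': "0 < d'" "ball c d' \<subseteq> ball 0 R"
    using openE[OF open_ball c] by blast
  define r where "r = min d d'"
  have sub: "ball c r \<subseteq> ball 0 R"
    using d'(2) by (auto simp: r_def)
  have close: "dist (a0 \<omega>) (a0 c) < e / 2" if "\<omega> \<in> ball c r" for \<omega>
    using that d(2)[of \<omega>] by (auto simp: r_def dist_commute)
  have "\<forall>\<^sub>F n in F. \<forall>\<omega>\<in>ball 0 R. dist (a n \<omega>) (a0 \<omega>) < e / 2"
    using e(1) by (intro uniform_limitD[OF lim]) simp
  then have ev: "\<forall>\<^sub>F n in F. a n ` ball c r \<subseteq> cball (a0 c) e"
  proof eventually_elim
    case (elim n)
    have "dist (a n \<omega>) (a0 c) \<le> e" if "\<omega> \<in> ball c r" for \<omega>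
    proof -
      have "dist (a n \<omega>) (a0 \<omega>) < e / 2"
        using elim sub that by blast
      then show ?thesis
        using close[OF that] dist_triangle[of "a n \<omega>" "a0 c" "a0 \<omega>"] by linarith
    qed
    then show ?case
      by (auto simp: dist_commute)
  qed
  have "a0 \<omega> \<in> cball (a0 c) e" if "\<omega> \<in> ball c r" for \<omega>
    using close[OF that] e(1) by (simp add: dist_commute)
  then have "a0 ` ball c r \<subseteq> cball (a0 c) e"
    by blast
  then show ?thesis
    using that[OF _ sub compact_cball e(2) _ ev] d(1) d'(1) by (simp add: r_def)
qed

text \<open>If zeros were missing for \<delta> arbitrarily close to 0, a sequence of such \<delta>
  tending to 0 would yield zero-free functions, and the sequential theorem
  \<open>Hurwitz_no_zeros\<close> would exclude the zero of \<open>g\<close>.\<close>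

lemma Hurwitz_eventually_zero:
  fixes f :: "real \<Rightarrow> complex \<Rightarrow> complex"
  assumes S: "open S" "connected S" and hol: "\<forall>\<^sub>F \<delta> in at_right 0. f \<delta> holomorphic_on S"
    and g: "g holomorphic_on S" and lim: "uniform_limit S f g (at_right 0)"
    and nonconst: "\<not> g constant_on S" and z0: "z0 \<in> S" "g z0 = 0"
  shows "\<forall>\<^sub>F \<delta> in at_right 0. \<exists>z\<in>S. f \<delta> z = 0"
proof (rule ccontr)
  assume "\<not> ?thesis"
  then have freq: "\<exists>\<^sub>F \<delta> in at_right 0. \<forall>z\<in>S. f \<delta> z \<noteq> 0"
    by (simp add: frequently_def)
  have "\<exists>\<delta>. (\<forall>z\<in>S. f \<delta> z \<noteq> 0) \<and> f \<delta> holomorphic_on S \<and> 0 < \<delta> \<and> \<delta> < inverse (real (Suc n))" for n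
  proof -
    have "\<forall>\<^sub>F \<delta> in at_right 0. \<delta> \<in> {0<..<inverse (real (Suc n))}"
      by (rule eventually_at_right_real) simp
    with hol have "\<forall>\<^sub>F \<delta> in at_right 0. f \<delta> holomorphic_on S \<and> 0 < \<delta> \<and> \<delta> < inverse (real (Suc n))"
      by eventually_elim auto
    from frequently_ex[OF frequently_eventually_frequently[OF freq this]] show ?thesis
      by blast
  qed
  then obtain \<delta> where \<delta>: "\<And>n z. z \<in> S \<Longrightarrow> f (\<delta> n) z \<noteq> 0" "\<And>n. f (\<delta> n) holomorphic_on S"
    "\<And>n. 0 < \<delta> n" "\<And>n. \<delta> n < inverse (real (Suc n))"
    by metis
  have "\<delta> \<longlonglongrightarrow> 0"
    by (rule tendsto_sandwich[OF _ _ tendsto_const LIMSEQ_inverse_real_of_nat])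
      (use \<delta>(3,4) in \<open>auto intro: always_eventually less_imp_le simp del: of_nat_Suc\<close>)
  moreover have "\<delta> n \<noteq> 0" for n
    using \<delta>(3)[of n] by simp
  ultimately have "filterlim \<delta> (at_right 0) sequentially"
    using \<delta>(3) by (simp add: filterlim_at)
  then have "uniform_limit S (\<lambda>n. f (\<delta> n)) g sequentially"
    unfolding uniform_limit_iff
    using uniform_limitD[OF lim] eventually_compose_filterlim by fast
  then have "uniform_limit K (\<lambda>n. f (\<delta> n)) g sequentially" if "K \<subseteq> S" for K
    using that uniform_limit_on_subset by blast
  then have "g z0 \<noteq> 0"
    by (rule Hurwitz_no_zeros[where \<F> = "\<lambda>n. f (\<delta> n)", OF S \<delta>(2) g _ nonconst \<delta>(1) z0(1)])
  then show False
    using z0(2) by simp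
qed

text \<open>How small \<delta> must be depends on r. Taking for each \<delta> a point of
  \<open>Q \<delta>\<close> almost closest to \<open>c\<close> makes the choice independent of r;
  the slack \<delta> is there because the infimum of the distances need not be attained, and it
  vanishes in the limit.\<close>

lemma choose_convergent_selection:
  fixes Q :: "real \<Rightarrow> complex \<Rightarrow> bool"
  assumes "\<And>r. 0 < r \<Longrightarrow> \<forall>\<^sub>F \<delta> in at_right 0. \<exists>\<omega>\<in>ball c r. Q \<delta> \<omega>"
  shows "\<exists>f. (\<forall>\<^sub>F \<delta> in at_right 0. Q \<delta> (f \<delta>)) \<and> (f \<longlongrightarrow> c) (at_right 0)"
proof -
  define f where "f \<delta> = (SOME \<omega>. Q \<delta> \<omega> \<and> dist c \<omega> < infdist c {\<omega>. Q \<delta> \<omega>} + \<delta>)" for \<delta>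
  have f: "Q \<delta> (f \<delta>) \<and> dist c (f \<delta>) < infdist c {\<omega>. Q \<delta> \<omega>} + \<delta>" if "0 < \<delta>" "Q \<delta> \<omega>" for \<delta> \<omega>
    unfolding f_def
  proof (rule someI_ex)
    have ne: "{\<omega>. Q \<delta> \<omega>} \<noteq> {}"
      using that by auto
    have "(INF \<omega>\<in>{\<omega>. Q \<delta> \<omega>}. dist c \<omega>) < infdist c {\<omega>. Q \<delta> \<omega>} + \<delta>"
      using that(1) by (simp add: infdist_notempty[OF ne])
    then show "\<exists>\<omega>. Q \<delta> \<omega> \<and> dist c \<omega> < infdist c {\<omega>. Q \<delta> \<omega>} + \<delta>"
      using cINF_less_iff[OF ne, of "dist c"] by (auto intro: bdd_belowI[of _ 0])
  qed
  have pos: "\<forall>\<^sub>F \<delta> in at_right (0::real). 0 < \<delta>"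
    by (simp add: eventually_at_right_less)
  have "\<forall>\<^sub>F \<delta> in at_right 0. Q \<delta> (f \<delta>)"
    using assms[of 1, OF zero_less_one] pos by eventually_elim (use f in blast)
  moreover have "(f \<longlongrightarrow> c) (at_right 0)"
  proof (rule tendstoI)
    fix e :: real assume e: "0 < e"
    then have "\<forall>\<^sub>F \<delta> in at_right 0. \<delta> \<in> {0<..<e / 2}"
      by (intro eventually_at_right_real) simp
    moreover have "\<forall>\<^sub>F \<delta> in at_right 0. \<exists>\<omega>\<in>ball c (e / 2). Q \<delta> \<omega>"
      using assms e by simp
    ultimately show "\<forall>\<^sub>F \<delta> in at_right 0. dist (f \<delta>) c < e"
    proof eventually_elim
      case (elim \<delta>)
      then obtain \<omega> where "dist c \<omega> < e / 2" "Q \<delta> \<omega>"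
        by auto
      then show ?case
        using f[of \<delta> \<omega>] infdist_le[of \<omega> "{\<omega>. Q \<delta> \<omega>}" c] elim(1) by (auto simp: dist_commute)
    qed
  qed
  ultimately show ?thesis by blast
qed

text \<open>The imaginary part of a square is twice the product of the real and imaginary parts, so
  a point off both axes is wanted. Each vanishing coordinate is moved by r / 3, and the total shift
  stays below r.\<close>

lemma nonreal_square_in_ball:
  fixes c :: complex
  assumes "0 < r"
  obtains \<omega> where "\<omega> \<in> ball c r" "Im (\<omega>\<^sup>2) \<noteq> 0"
proof -
  define x y where "x = (if Re c = 0 then r / 3 else 0)" and "y = (if Im c = 0 then r / 3 else 0)"
  let ?\<omega> = "c + Complex x y"
  have "norm (Complex x y) \<le> \<bar>x\<bar> + \<bar>y\<bar>"
    using cmod_le[of "Complex x y"] by simp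
  also have "\<dots> < r"
    using assms by (auto simp: x_def y_def)
  finally have "?\<omega> \<in> ball c r"
    by (simp add: dist_norm)
  moreover have "Im (?\<omega>\<^sup>2) \<noteq> 0"
    using assms by (auto simp: x_def y_def power2_eq_square)
  ultimately show ?thesis
    using that by blast
qed

lemma uniform_limit_decay_root:
  assumes lim: "uniform_limit X a a0 F" and K: "compact K" "K \<subseteq> - (complex_of_real ` {-1..1})"
    and a: "\<forall>\<^sub>F n in F. a n ` X \<subseteq> K" and a0: "a0 ` X \<subseteq> K"
  shows "uniform_limit X (\<lambda>n \<omega>. decay_root (a n \<omega>)) (\<lambda>\<omega>. decay_root (a0 \<omega>)) F"
    and "bounded ((\<lambda>\<omega>. decay_root (a0 \<omega>)) ` X)"
proof -
  have cont: "continuous_on K decay_root"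
    using holomorphic_decay_root K(2) holomorphic_on_imp_continuous_on continuous_on_subset by blast
  from uniform_limit_compose[OF lim compact_uniformly_continuous[OF this K(1)] a a0]
  show "uniform_limit X (\<lambda>n \<omega>. decay_root (a n \<omega>)) (\<lambda>\<omega>. decay_root (a0 \<omega>)) F"
    by (simp add: o_def)
  have "bounded (decay_root ` K)"
    by (intro compact_imp_bounded compact_continuous_image cont K(1))
  then show "bounded ((\<lambda>\<omega>. decay_root (a0 \<omega>)) ` X)"
    by (rule bounded_subset) (use a0 in auto)
qed

theorem theorem2p1:
  fixes mu0 x0 :: real
    and epsA epsB :: "real \<Rightarrow> real \<Rightarrow> complex"
    and \<omega>U :: complex
  assumes "mu0 > 0"
    and "damped_family x0 epsA"
    and "damped_family x0 epsB"
    and "\<omega>U \<in> common_band_gap mu0 (epsA 0) (epsB 0)"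
    and "interface_impedance mu0 x0 (epsA 0) (epsB 0) \<omega>U = 0"
  shows "\<exists>\<omega>D :: real \<Rightarrow> complex.
           (\<forall>\<^sub>F \<delta> in at_right 0.
              \<omega>D \<delta> \<in> common_band_gap mu0 (epsA \<delta>) (epsB \<delta>) \<and>
              interface_impedance mu0 x0 (epsA \<delta>) (epsB \<delta>) (\<omega>D \<delta>) = 0) \<and>
           (\<omega>D \<longlongrightarrow> \<omega>U) (at_right 0)"
proof (rule choose_convergent_selection)
  \<comment> \<open>It remains to find, for each radius r, a root within r of
    \<open>\<omega>U\<close> for all small \<delta>.\<close>
  fix r :: real assume "0 < r"
  let ?m = "- complex_of_real mu0" and ?I = "complex_of_real ` {-1..1}"
  define aA bA where "aA \<delta> \<omega> = fund_u1 x0 ?m (epsA \<delta>) \<omega> (x0 + 1)"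
    and "bA \<delta> \<omega> = fund_u2 x0 ?m (epsA \<delta>) \<omega> (x0 + 1)" for \<delta> \<omega>
  define aB bB where "aB \<delta> \<omega> = fund_u1 x0 ?m (epsB \<delta>) \<omega> (x0 + 1)"
    and "bB \<delta> \<omega> = fund_u2 x0 ?m (epsB \<delta>) \<omega> (x0 + 1)" for \<delta> \<omega>
  define Z where "Z \<delta> \<omega> = bA \<delta> \<omega> * decay_root (aB \<delta> \<omega>) + bB \<delta> \<omega> * decay_root (aA \<delta> \<omega>)" for \<delta> \<omega>
  define R where "R = norm \<omega>U + 1"
  have R: "0 \<le> R" "\<omega>U \<in> ball 0 R"
    by (simp_all add: R_def)
  obtain MA where medA0: "permittivity_medium x0 mu0 (epsA 0) MA"
    and medA: "\<forall>\<^sub>F \<delta> in at_right 0. permittivity_medium x0 mu0 (epsA \<delta>) MA"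
    and limA: "uniform_limit (ball 0 R) aA (aA 0) (at_right 0)"
      "uniform_limit (ball 0 R) bA (bA 0) (at_right 0)"
    unfolding aA_def bA_def using damped_family_limits[OF assms(1,2)] R(1) by metis
  obtain MB where medB0: "permittivity_medium x0 mu0 (epsB 0) MB"
    and medB: "\<forall>\<^sub>F \<delta> in at_right 0. permittivity_medium x0 mu0 (epsB \<delta>) MB"
    and limB: "uniform_limit (ball 0 R) aB (aB 0) (at_right 0)"
      "uniform_limit (ball 0 R) bB (bB 0) (at_right 0)"
    unfolding aB_def bB_def using damped_family_limits[OF assms(1,3)] R(1) by metis
  have holo: "(\<lambda>\<omega>. fund_u1 x0 ?m e \<omega> (x0 + 1)) holomorphic_on S \<and>
      (\<lambda>\<omega>. fund_u2 x0 ?m e \<omega> (x0 + 1)) holomorphic_on S"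
    if "permittivity_medium x0 mu0 e M" for e M S
  proof -
    interpret permittivity_medium x0 mu0 e M by fact
    show ?thesis
      using fund_u1_holomorphic[OF weight_eps weight_m] fund_u2_holomorphic[OF weight_eps weight_m] by blast
  qed
  note iff0 = common_band_gap_iff[OF medA0 medB0, folded aA_def aB_def]
  have opn: "open (- ?I)"
    using compact_real_segment by (simp add: compact_imp_closed open_Compl)
  have isCont: "isCont (aA 0) \<omega>U" "isCont (aB 0) \<omega>U"
    unfolding aA_def aB_def using holo[OF medA0, of UNIV] holo[OF medB0, of UNIV]
    by (auto dest!: holomorphic_on_imp_continuous_on simp: continuous_on_eq_continuous_at)
  obtain rA KA where A: "0 < rA" "ball \<omega>U rA \<subseteq> ball 0 R" "compact KA" "KA \<subseteq> - ?I"
    "aA 0 ` ball \<omega>U rA \<subseteq> KA" "\<forall>\<^sub>F \<delta> in at_right 0. aA \<delta> ` ball \<omega>U rA \<subseteq> KA"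
    by (rule uniform_limit_in_compact[OF limA(1) isCont(1) R(2) opn]) (use assms(4) iff0 in auto)
  obtain rB KB where B: "0 < rB" "ball \<omega>U rB \<subseteq> ball 0 R" "compact KB" "KB \<subseteq> - ?I"
    "aB 0 ` ball \<omega>U rB \<subseteq> KB" "\<forall>\<^sub>F \<delta> in at_right 0. aB \<delta> ` ball \<omega>U rB \<subseteq> KB"
    by (rule uniform_limit_in_compact[OF limB(1) isCont(2) R(2) opn]) (use assms(4) iff0 in auto)
  \<comment> \<open>Small enough for the target radius and for both materials; as a ball it is open
    and connected, as Hurwitz' theorem requires.\<close>
  define S where "S = ball \<omega>U (min r (min rA rB))"
  have SA: "S \<subseteq> ball \<omega>U rA" and SB: "S \<subseteq> ball \<omega>U rB" and Sr: "S \<subseteq> ball \<omega>U r" and SR: "S \<subseteq> ball 0 R"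
    using A(2) by (auto simp: S_def)
  have r0: "0 < min r (min rA rB)"
    using \<open>0 < r\<close> A(1) B(1) by simp
  have "\<omega>U \<in> S"
    using r0 by (simp add: S_def)
  have evA: "\<forall>\<^sub>F \<delta> in at_right 0. aA \<delta> ` S \<subseteq> KA" and A0: "aA 0 ` S \<subseteq> KA"
    using A(5,6) SA by (auto elim!: eventually_mono)
  have evB: "\<forall>\<^sub>F \<delta> in at_right 0. aB \<delta> ` S \<subseteq> KB" and B0: "aB 0 ` S \<subseteq> KB"
    using B(5,6) SB by (auto elim!: eventually_mono)
  \<comment> \<open>The product rule for uniform limits requires bounded limit functions.\<close>
  have bounded: "bounded (bA 0 ` S)" "bounded (bB 0 ` S)"
  proof -
    have "bounded (f ` S)" if "f holomorphic_on UNIV" for f :: "complex \<Rightarrow> complex"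
    proof -
      have "compact (f ` cball 0 R)"
        using that by (intro compact_continuous_image)
          (auto intro: holomorphic_on_imp_continuous_on holomorphic_on_subset)
      then show ?thesis
        using SR ball_subset_cball by (meson bounded_subset compact_imp_bounded image_mono order_trans)
    qed
    then show "bounded (bA 0 ` S)" "bounded (bB 0 ` S)"
      using holo[OF medA0] holo[OF medB0] by (simp_all add: bA_def bB_def)
  qed
  note rootA = uniform_limit_decay_root[OF uniform_limit_on_subset[OF limA(1) SR] A(3,4) evA A0]
  note rootB = uniform_limit_decay_root[OF uniform_limit_on_subset[OF limB(1) SR] B(3,4) evB B0]
  have lim: "uniform_limit S Z (Z 0) (at_right 0)"
    unfolding Z_def using limA(2) limB(2) SR
    by (intro uniform_limit_add uniform_lim_mult rootA rootB bounded) (auto intro: uniform_limit_on_subset)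
  have holZ: "Z \<delta> holomorphic_on S"
    if "permittivity_medium x0 mu0 (epsA \<delta>) MA" "permittivity_medium x0 mu0 (epsB \<delta>) MB"
      "aA \<delta> ` S \<subseteq> KA" "aB \<delta> ` S \<subseteq> KB" for \<delta>
  proof -
    have root: "(\<lambda>\<omega>. decay_root (f \<omega>)) holomorphic_on S" if "f holomorphic_on S" "f ` S \<subseteq> - ?I" for f
      using holomorphic_on_compose_gen[OF that(1) holomorphic_decay_root that(2)] by (simp add: o_def)
    have "aA \<delta> holomorphic_on S" "bA \<delta> holomorphic_on S" "aB \<delta> holomorphic_on S" "bB \<delta> holomorphic_on S"
      using holo[OF that(1)] holo[OF that(2)] by (simp_all add: aA_def[abs_def] bA_def[abs_def] aB_def[abs_def] bB_def[abs_def])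
    then show ?thesis
      unfolding Z_def using that(3,4) A(4) B(4) by (intro holomorphic_intros root) auto
  qed
  have gap: "\<omega> \<in> common_band_gap mu0 (epsA \<delta>) (epsB \<delta>) \<and>
      (interface_impedance mu0 x0 (epsA \<delta>) (epsB \<delta>) \<omega> = 0 \<longleftrightarrow> Z \<delta> \<omega> = 0)"
    if med: "permittivity_medium x0 mu0 (epsA \<delta>) MA" "permittivity_medium x0 mu0 (epsB \<delta>) MB"
      and "aA \<delta> ` S \<subseteq> KA" "aB \<delta> ` S \<subseteq> KB" "\<omega> \<in> S" for \<delta> \<omega>
  proof -
    have "aA \<delta> \<omega> \<notin> ?I" "aB \<delta> \<omega> \<notin> ?I"
      using that(3-5) A(4) B(4) by blast+
    then have "\<omega> \<in> common_band_gap mu0 (epsA \<delta>) (epsB \<delta>)"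
      unfolding common_band_gap_iff[OF med] aA_def aB_def by blast
    then show ?thesis
      using interface_impedance_zero_iff[OF med] by (simp add: Z_def aA_def aB_def bA_def bB_def)
  qed
  \<comment> \<open>At such a point the undamped impedance cannot vanish; together with the zero at
    \<open>\<omega>U\<close> this shows that \<open>Z 0\<close> is not constant.\<close>
  obtain \<omega>' where \<omega>': "\<omega>' \<in> S" "Im (\<omega>'\<^sup>2) \<noteq> 0"
    using nonreal_square_in_ball[OF r0, of \<omega>U] by (auto simp: S_def)
  have real: "epsA 0 x \<in> \<real>" "epsB 0 x \<in> \<real>" for x
    using assms(2,3) by (auto simp: damped_family_def)
  have "Z 0 \<omega>' \<noteq> 0"
    using interface_impedance_nonreal[OF medA0 medB0 _ real \<omega>'(2)] gap[OF medA0 medB0 A0 B0 \<omega>'(1)] by blast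
  moreover have root0: "Z 0 \<omega>U = 0"
    using gap[OF medA0 medB0 A0 B0 \<open>\<omega>U \<in> S\<close>] assms(5) by blast
  ultimately have nonconst: "\<not> Z 0 constant_on S"
    using \<omega>'(1) \<open>\<omega>U \<in> S\<close> unfolding constant_on_def by metis
  have "\<forall>\<^sub>F \<delta> in at_right 0. Z \<delta> holomorphic_on S"
    using medA medB evA evB by eventually_elim (rule holZ)
  then have "\<forall>\<^sub>F \<delta> in at_right 0. \<exists>\<omega>\<in>S. Z \<delta> \<omega> = 0"
    by (intro Hurwitz_eventually_zero[OF _ _ _ holZ[OF medA0 medB0 A0 B0] lim nonconst \<open>\<omega>U \<in> S\<close> root0])
      (auto simp: S_def)
  then show "\<forall>\<^sub>F \<delta> in at_right 0. \<exists>\<omega>\<in>ball \<omega>U r.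
      \<omega> \<in> common_band_gap mu0 (epsA \<delta>) (epsB \<delta>) \<and>
      interface_impedance mu0 x0 (epsA \<delta>) (epsB \<delta>) \<omega> = 0"
    using medA medB evA evB
  proof eventually_elim
    case (elim \<delta>)
    then obtain \<omega> where "\<omega> \<in> S" "Z \<delta> \<omega> = 0"
      by blast
    then show ?case
      using gap[OF elim(2-5)] Sr by blast
  qed
qed

end
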